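(* A permutation class $\mathcal{C}\subseteq\operatorname{Av}(321)$ is well-quasi-ordered (under permutation containment) if and only if $\mathcal{C}\cap U$ is finite.
   Context: A permutation class is a set of permutations closed downward under containment; it is well-quasi-ordered if it contains no infinite antichain. For a permutation $\pi$, the inversion graph $G_\pi$ has vertex set $\{(i,\pi(i))\}$, with $(i,\pi(i))$ and $(j,\pi(j))$ adjacent if $i<j$ and $\pi(i)>\pi(j)$. A double-ended fork is the graph formed from a path by adding four new vertices of degree one, two adjacent to one end of the path and two adjacent to the other end. $U$ is the set of all permutations whose inversion graph is isomorphic to a double-ended fork. *)

theory Defs
  imports "HOL-Combinatorics.Multiset_Permutations" "HOL-Library.Sublist"
begin

text \<open>
  Permutations are in one-line notation: the permutation \<open>\<pi>\<close> of \<open>{1..n}\<close> is the list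
  \<open>[\<pi>(1), \<dots>, \<pi>(n)]\<close>. The empty permutation is included.
\<close>

definition perms :: "nat list set" where
  "perms = (\<Union>n. permutations_of_set {1..n})"

definition order_isomorphic :: "nat list \<Rightarrow> nat list \<Rightarrow> bool" where
  "order_isomorphic xs ys \<longleftrightarrow> length xs = length ys \<and>
     (\<forall>i<length xs. \<forall>j<length xs. xs ! i < xs ! j \<longleftrightarrow> ys ! i < ys ! j)"

definition perm_contained :: "nat list \<Rightarrow> nat list \<Rightarrow> bool" (infix "\<preceq>" 50) where
  "\<sigma> \<preceq> \<pi> \<longleftrightarrow> (\<exists>ys. subseq ys \<pi> \<and> order_isomorphic \<sigma> ys)"

definition Av :: "nat list \<Rightarrow> nat list set" where
  "Av \<beta> = {\<pi> \<in> perms. \<not> \<beta> \<preceq> \<pi>}"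

definition perm_class :: "nat list set \<Rightarrow> bool" where
  "perm_class C \<longleftrightarrow> C \<subseteq> perms \<and> (\<forall>\<pi>\<in>C. \<forall>\<sigma>\<in>perms. \<sigma> \<preceq> \<pi> \<longrightarrow> \<sigma> \<in> C)"

definition antichain :: "nat list set \<Rightarrow> bool" where
  "antichain A \<longleftrightarrow> (\<forall>\<sigma>\<in>A. \<forall>\<pi>\<in>A. \<sigma> \<noteq> \<pi> \<longrightarrow> \<not> \<sigma> \<preceq> \<pi>)"

definition well_quasi_ordered :: "nat list set \<Rightarrow> bool" where
  "well_quasi_ordered C \<longleftrightarrow> \<not> (\<exists>A\<subseteq>C. infinite A \<and> antichain A)"

text \<open>A simple graph is a vertex set together with a set of two-element sets of vertices.\<close>

type_synonym 'a graph = "'a set \<times> 'a set set"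

definition graph_isomorphic :: "'a graph \<Rightarrow> 'b graph \<Rightarrow> bool" where
  "graph_isomorphic G H \<longleftrightarrow>
     (\<exists>f. bij_betw f (fst G) (fst H) \<and>
       (\<forall>u\<in>fst G. \<forall>v\<in>fst G. {u, v} \<in> snd G \<longleftrightarrow> {f u, f v} \<in> snd H))"

text \<open>The index shift below is due to list positions starting at \<open>0\<close>.\<close>

definition points :: "nat list \<Rightarrow> (nat \<times> nat) set" where
  "points \<pi> = {(i, \<pi> ! (i - 1)) | i. i \<in> {1..length \<pi>}}"

definition inversion_graph :: "nat list \<Rightarrow> (nat \<times> nat) graph" where
  "inversion_graph \<pi> =
     (points \<pi>,
      {{(i, a), (j, b)} | i a j b.
         (i, a) \<in> points \<pi> \<and> (j, b) \<in> points \<pi> \<and> i < j \<and> a > b})"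

text \<open>
  The path has vertices \<open>0, \<dots>, n - 1\<close>; the four new vertices are \<open>n, \<dots>, n + 3\<close>, of which
  the first two are attached to the end \<open>0\<close> and the last two to the end \<open>n - 1\<close>.
\<close>

definition double_ended_fork :: "nat \<Rightarrow> nat graph" where
  "double_ended_fork n =
     ({..<n + 4},
      {{i, i + 1} | i. i + 1 < n} \<union>
      {{0, n}, {0, n + 1}, {n - 1, n + 2}, {n - 1, n + 3}})"

text \<open>
  The bound \<open>n \<ge> 2\<close> says that the path has two distinct ends; the one-vertex path would
  only add the star with four leaves.
\<close>

definition fork_perms :: "nat list set" where
  "fork_perms =
     {\<pi> \<in> perms. \<exists>n\<ge>2. graph_isomorphic (inversion_graph \<pi>) (double_ended_fork n)}"

end

theory Submission
  imports Defs "HOL-Library.Ramsey"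
begin

text \<open>
  Fork permutations form an antichain because an embedding of double-ended forks sends the two
  vertices of degree three to vertices of degree three and cannot increase distances.

  Conversely, the breadth-first layers of a connected component of a 321-avoiding point set,
  starting from its leftmost point, are increasing sequences in consecutive cells of a staircase,
  and the last points of the layers form an induced path. A layer with a second point yields a fork
  at one end of a piece of this path, so two such layers far apart yield a long double-ended fork.
  If long forks are excluded, all layers outside a window of bounded length are therefore single
  points. Reading the points in a suitable order encodes the component by a word over the cells
  consisting of two monotone runs around a word over a bounded alphabet, and the subword order
  implies containment. Higman's lemma is applied once to these words and once to sequences of
  components.
\<close>

section \<open>Higman's lemma\<close>

text \<open>Higman's lemma does not apply to the staircase words directly: a component may spread
  over arbitrarily many cells, so the alphabet is unbounded. Outside the window, however, a word is
  determined by the lengths of its two runs, and shifting all cells by an even amount changes no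
  relative order. The parity of the start of the window, the word over the window and two lengths
  thus describe a component, and these data can be written over one finite alphabet. The start of a
  component is the other obstacle. A layer with two points always supplies the right end of a fork,
  but a left end needs two leaves at one path vertex, and the second leaf is normally the last point
  of an earlier or equal layer; this works from layer 2 on. A single extra point of layer 1 that is
  not adjacent to the path vertex of layer 2 yields no fork. It merely prolongs the path backwards
  and has to be absorbed into the lower run of the word.\<close>

definition wqo_set :: "('a \<Rightarrow> 'a \<Rightarrow> bool) \<Rightarrow> 'a set \<Rightarrow> bool" where
  "wqo_set P A \<longleftrightarrow> (\<forall>f :: nat \<Rightarrow> 'a. range f \<subseteq> A \<longrightarrow> (\<exists>i j. i < j \<and> P (f i) (f j)))"

text \<open>Ramsey's theorem for pairs coloured good or bad: an infinite homogeneous set of bad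
  pairs would itself be a sequence contradicting the hypothesis.\<close>

lemma wqo_set_monotone_subsequence:
  assumes "wqo_set P A" and "range f \<subseteq> A"
  shows "\<exists>g :: nat \<Rightarrow> nat. strict_mono g \<and> (\<forall>i j. i < j \<longrightarrow> P (f (g i)) (f (g j)))"
proof -
  define col :: "nat set \<Rightarrow> nat" where "col X = (if P (f (Min X)) (f (Max X)) then 0 else 1)" for X
  have "\<forall>x\<in>UNIV. \<forall>y\<in>UNIV. x \<noteq> y \<longrightarrow> col {x, y} < 2" by (auto simp: col_def)
  from Ramsey2[OF infinite_UNIV_nat this]
  obtain Y t where Y: "infinite Y" "\<forall>x\<in>Y. \<forall>y\<in>Y. x \<noteq> y \<longrightarrow> col {x, y} = t" by blast
  define g where "g = enumerate Y"
  have g: "strict_mono g" using Y(1) by (simp add: g_def strict_mono_enumerate)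
  have gY: "g i \<in> Y" for i using Y(1) by (simp add: g_def enumerate_in_set)
  have colt: "col {g i, g j} = t" if "i < j" for i j
    using Y(2) gY g that by (metis strict_mono_less less_irrefl)
  have coleq: "col {g i, g j} = (if P (f (g i)) (f (g j)) then 0 else 1)" if "i < j" for i j
    using strict_monoD[OF g that] by (simp add: col_def)
  have "range (f \<circ> g) \<subseteq> A" using assms(2) by auto
  then obtain i j where "i < j" "P (f (g i)) (f (g j))"
    using assms(1) unfolding wqo_set_def by (metis comp_apply)
  then have "t = 0" using colt coleq by fastforce
  then have "P (f (g i)) (f (g j))" if "i < j" for i j
    using colt[OF that] coleq[OF that] by (auto split: if_splits)
  then show ?thesis using g by blast
qed

lemma wqo_set_eq_finite:
  assumes "finite A"
  shows "wqo_set (=) A"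
  unfolding wqo_set_def
proof (intro allI impI)
  fix f :: "nat \<Rightarrow> 'a" assume "range f \<subseteq> A"
  then have "\<not> inj f" using assms by (meson finite_subset infinite_UNIV_nat finite_imageD)
  then show "\<exists>i j. i < j \<and> f i = f j" by (metis injI linorder_neqE_nat)
qed

text \<open>Nash-Williams' minimal bad sequence argument.\<close>

theorem higman:
  assumes "wqo_set P A"
  shows "wqo_set (list_emb P) (lists A)"
proof (rule ccontr)
  define bad where "bad f \<longleftrightarrow> range f \<subseteq> lists A \<and> (\<forall>i j. i < j \<longrightarrow> \<not> list_emb P (f i) (f j))"
    for f :: "nat \<Rightarrow> 'a list"
  assume "\<not> wqo_set (list_emb P) (lists A)"
  then obtain f0 where f0: "bad f0" unfolding wqo_set_def bad_def by blast
  define minimal where "minimal n f \<longleftrightarrow> bad f \<and>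
      (\<forall>g. bad g \<and> (\<forall>i<n. g i = f i) \<longrightarrow> length (f n) \<le> length (g n))"
    for n :: nat and f :: "nat \<Rightarrow> 'a list"
  have ex_min: "\<exists>g. minimal n g \<and> (\<forall>i<n. g i = f i)" if "bad f" for n f
  proof -
    define Q where "Q g \<longleftrightarrow> bad g \<and> (\<forall>i<n. g i = f i)" for g
    have "Q f" using that by (simp add: Q_def)
    obtain g where g: "Q g" "\<And>h. Q h \<Longrightarrow> length (g n) \<le> length (h n)"
      using \<open>Q f\<close> arg_min_nat_lemma[of Q f "\<lambda>g. length (g n)"] by blast
    have "minimal n g" unfolding minimal_def
    proof (intro conjI allI impI)
      show "bad g" using g(1) by (simp add: Q_def)
    next
      fix h assume "bad h \<and> (\<forall>i<n. h i = g i)"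
      then have "Q h" using g(1) by (simp add: Q_def)
      then show "length (g n) \<le> length (h n)" by (rule g(2))
    qed
    then show ?thesis using g(1) by (auto simp: Q_def)
  qed
  \<comment> \<open>Stage \<open>n\<close> fixes entry \<open>n\<close> with least length and later
    stages never change it, so the diagonal \<open>d\<close> is bad and minimal at every
    position.\<close>
  have "\<exists>F. \<forall>n. minimal n (F n) \<and> (\<forall>i\<le>n. F (Suc n) i = F n i)"
  proof (rule dependent_nat_choice)
    show "\<exists>x. minimal 0 x" using ex_min[OF f0, of 0] by blast
  next
    fix x n assume "minimal n x"
    then have "bad x" by (simp add: minimal_def)
    from ex_min[OF this, of "Suc n"]
    show "\<exists>y. minimal (Suc n) y \<and> (\<forall>i\<le>n. y i = x i)" by (auto simp: less_Suc_eq_le)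
  qed
  then obtain F where F: "\<And>n. minimal n (F n)" "\<And>n i. i \<le> n \<Longrightarrow> F (Suc n) i = F n i" by blast
  define d where "d n = F n n" for n
  have dF: "F n i = d i" if "i \<le> n" for n i
    using that
  proof (induction n)
    case (Suc n)
    then show ?case using F(2)[of i n] by (cases "i = Suc n") (simp_all add: d_def)
  qed (simp add: d_def)
  have badF: "bad (F n)" for n using F(1) by (simp add: minimal_def)
  have d_in: "d n \<in> lists A" for n using badF[of n] by (auto simp: bad_def d_def)
  have d_bad: "\<not> list_emb P (d i) (d j)" if "i < j" for i j
    using badF[of j] that dF[of i j] dF[of j j] unfolding bad_def by (metis less_imp_le order_refl)
  have d_min: "length (d n) \<le> length (g n)" if "bad g" "\<And>i. i < n \<Longrightarrow> g i = d i" for g n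
  proof -
    have "g i = F n i" if "i < n" for i using \<open>\<And>i. i < n \<Longrightarrow> g i = d i\<close>[OF that] dF[of i n] that by simp
    then show ?thesis using F(1)[of n] \<open>bad g\<close> unfolding minimal_def d_def by blast
  qed
  have ne: "d n \<noteq> []" for n using d_bad[of n "Suc n"] by auto
  have "hd (d n) \<in> A" for n using d_in[of n] ne[of n] by (cases "d n") auto
  then have "range (\<lambda>n. hd (d n)) \<subseteq> A" by auto
  from wqo_set_monotone_subsequence[OF assms this]
  obtain g :: "nat \<Rightarrow> nat" where g: "strict_mono g" "\<forall>i j. i < j \<longrightarrow> P (hd (d (g i))) (hd (d (g j)))"
    by blast
  \<comment> \<open>The first \<open>g 0\<close> entries of \<open>d\<close>, followed by the tails
    along a subsequence whose heads are pairwise related. It is again bad, but shorter than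
    \<open>d\<close> at position \<open>g 0\<close>.\<close>
  define e where "e n = (if n < g 0 then d n else tl (d (g (n - g 0))))" for n
  have e_le: "list_emb P x (d (g (n - g 0)))" if "list_emb P x (e n)" "\<not> n < g 0" for x n
    using that list_emb_Cons[of P x "tl (d (g (n - g 0)))" "hd (d (g (n - g 0)))"]
      ne[of "g (n - g 0)"] by (simp add: e_def)
  have "bad e" unfolding bad_def
  proof (intro conjI allI impI)
    have "e n \<in> lists A" for n
    proof (cases "n < g 0")
      case False
      then show ?thesis
        using list.set_sel(2)[OF ne[of "g (n - g 0)"]] d_in[of "g (n - g 0)"]
        by (auto simp: e_def)
    qed (use d_in in \<open>auto simp: e_def\<close>)
    then show "range e \<subseteq> lists A" by blast
  next
    fix i j :: nat assume "i < j"
    show "\<not> list_emb P (e i) (e j)"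
    proof
      assume emb: "list_emb P (e i) (e j)"
      show False
      proof (cases "j < g 0")
        case True
        then show False using emb d_bad[OF \<open>i < j\<close>] \<open>i < j\<close> by (simp add: e_def)
      next
        case j: False
        show False
        proof (cases "i < g 0")
          case True
          have "g 0 \<le> g (j - g 0)" using g(1) by (simp add: strict_mono_less_eq)
          then show False using e_le[OF emb j] True d_bad[of i "g (j - g 0)"] by (simp add: e_def)
        next
          case False
          then have lt: "i - g 0 < j - g 0" using \<open>i < j\<close> by linarith
          define a b where "a = g (i - g 0)" and "b = g (j - g 0)"
          have "a < b" using strict_monoD[OF g(1) lt] by (simp add: a_def b_def)
          have "list_emb P (tl (d a)) (tl (d b))" using emb False j by (simp add: e_def a_def b_def)
          then have "list_emb P (hd (d a) # tl (d a)) (hd (d b) # tl (d b))"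
            using g(2) lt by (auto simp: a_def b_def)
          then show False using d_bad[OF \<open>a < b\<close>] by (simp add: ne)
        qed
      qed
    qed
  qed
  from d_min[OF this, of "g 0"] show False
    using ne[of "g 0"] by (cases "d (g 0)") (simp_all add: e_def)
qed

section \<open>Permutations as point sets\<close>

definition order_emb :: "(nat \<times> nat \<Rightarrow> nat \<times> nat) \<Rightarrow> (nat \<times> nat) set \<Rightarrow> (nat \<times> nat) set \<Rightarrow> bool" where
  "order_emb f S T \<longleftrightarrow> f ` S \<subseteq> T \<and> (\<forall>p\<in>S. \<forall>q\<in>S.
     (fst p < fst q \<longleftrightarrow> fst (f p) < fst (f q)) \<and> (snd p < snd q \<longleftrightarrow> snd (f p) < snd (f q)))"

definition generic :: "(nat \<times> nat) set \<Rightarrow> bool" where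
  "generic S \<longleftrightarrow> finite S \<and> inj_on fst S \<and> inj_on snd S"

definition inversion :: "nat \<times> nat \<Rightarrow> nat \<times> nat \<Rightarrow> bool" where
  "inversion p q \<longleftrightarrow> (fst p < fst q \<and> snd q < snd p) \<or> (fst q < fst p \<and> snd p < snd q)"

lemma inversion_sym: "inversion p q \<longleftrightarrow> inversion q p"
  by (auto simp: inversion_def)

lemma generic_subset: "generic S \<Longrightarrow> T \<subseteq> S \<Longrightarrow> generic T"
  unfolding generic_def by (meson finite_subset inj_on_subset)

lemma order_emb_inversion:
  "order_emb f S T \<Longrightarrow> p \<in> S \<Longrightarrow> q \<in> S \<Longrightarrow> inversion (f p) (f q) \<longleftrightarrow> inversion p q"
  unfolding order_emb_def inversion_def by blast

lemma order_emb_inj: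
  assumes "order_emb f S T" and "generic S"
  shows "inj_on f S"
proof (rule inj_onI)
  fix p q assume pq: "p \<in> S" "q \<in> S" "f p = f q"
  then have "\<not> fst p < fst q" "\<not> fst q < fst p" using assms(1) unfolding order_emb_def by (metis less_irrefl)+
  then show "p = q" using pq assms(2) unfolding generic_def inj_on_def by (metis linorder_neqE_nat)
qed

lemma order_emb_mono: "order_emb f S T \<Longrightarrow> T \<subseteq> T' \<Longrightarrow> order_emb f S T'"
  unfolding order_emb_def by blast

lemma points_image: "points \<pi> = (\<lambda>i. (Suc i, \<pi> ! i)) ` {..<length \<pi>}"
proof (intro equalityI subsetI)
  fix p assume "p \<in> points \<pi>"
  then obtain i where "i \<in> {1..length \<pi>}" "p = (i, \<pi> ! (i - 1))" unfolding points_def by blast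
  then show "p \<in> (\<lambda>i. (Suc i, \<pi> ! i)) ` {..<length \<pi>}" by (intro image_eqI[of _ _ "i - 1"]) auto
next
  fix p assume "p \<in> (\<lambda>i. (Suc i, \<pi> ! i)) ` {..<length \<pi>}"
  then obtain i where "i < length \<pi>" "p = (Suc i, \<pi> ! i)" by blast
  then show "p \<in> points \<pi>" unfolding points_def by (intro CollectI exI[of _ "Suc i"]) auto
qed

lemma mem_perms_iff: "\<pi> \<in> perms \<longleftrightarrow> distinct \<pi> \<and> set \<pi> = {1..length \<pi>}"
proof
  assume "\<pi> \<in> perms"
  then obtain n where n: "set \<pi> = {1..n}" "distinct \<pi>"
    unfolding perms_def permutations_of_set_def by blast
  then have "length \<pi> = n" by (metis card_atLeastAtMost diff_Suc_1 distinct_card)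
  with n show "distinct \<pi> \<and> set \<pi> = {1..length \<pi>}" by simp
next
  assume "distinct \<pi> \<and> set \<pi> = {1..length \<pi>}"
  then show "\<pi> \<in> perms" unfolding perms_def permutations_of_set_def by blast
qed

lemma generic_points: "distinct \<pi> \<Longrightarrow> generic (points \<pi>)"
  unfolding generic_def points_image by (auto simp: inj_on_def nth_eq_iff_index_eq)

lemma card_points: "card (points \<pi>) = length \<pi>"
  unfolding points_image by (subst card_image) (auto simp: inj_on_def)

lemma subseq_iff_indices:
  "subseq ys xs \<longleftrightarrow> (\<exists>is. sorted_wrt (<) is \<and> set is \<subseteq> {..<length xs} \<and> ys = map ((!) xs) is)"
proof
  assume "subseq ys xs"
  then obtain N where N: "ys = nths xs N" using subseq_conv_nths by blast
  define js where "js = nths [0..<length xs] N"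
  have "ys = map ((!) xs) js" using nths_map[of "(!) xs" "[0..<length xs]" N] by (simp add: N js_def map_nth)
  moreover have "sorted_wrt (<) js" by (simp add: js_def strict_sorted_iff sorted_nths)
  moreover have "set js \<subseteq> {..<length xs}" using set_nths_subset[of "[0..<length xs]" N] by (auto simp: js_def)
  ultimately show "\<exists>is. sorted_wrt (<) is \<and> set is \<subseteq> {..<length xs} \<and> ys = map ((!) xs) is" by blast
next
  assume "\<exists>is. sorted_wrt (<) is \<and> set is \<subseteq> {..<length xs} \<and> ys = map ((!) xs) is"
  then obtain js where js: "sorted_wrt (<) js" "set js \<subseteq> {..<length xs}" "ys = map ((!) xs) js" by blast
  then have "subseq js [0..<length xs]" by (intro sorted_subset_imp_subseq) auto
  from subseq_map[OF this, of "(!) xs"] show "subseq ys xs" by (simp add: js(3) map_nth)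
qed

lemma sorted_wrt_less_nth_iff:
  assumes "sorted_wrt (<) (is :: nat list)" "i < length is" "j < length is"
  shows "is ! i < is ! j \<longleftrightarrow> i < j"
proof
  show "i < j" if "is ! i < is ! j"
  proof (rule ccontr)
    assume "\<not> i < j"
    then consider "j < i" | "i = j" by linarith
    then show False using that sorted_wrt_nth_less[OF assms(1), of j i] assms by cases auto
  qed
qed (use assms sorted_wrt_nth_less[OF assms(1)] in blast)

lemma order_emb_points_imp_contained:
  assumes "order_emb f (points \<sigma>) (points \<pi>)"
  shows "\<sigma> \<preceq> \<pi>"
proof -
  define h where "h i = f (Suc i, \<sigma> ! i)" for i
  define js where "js = map (\<lambda>i. fst (h i) - 1) [0..<length \<sigma>]"
  have P: "(Suc i, \<sigma> ! i) \<in> points \<sigma>" if "i < length \<sigma>" for i using that by (auto simp: points_image)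
  have h: "\<exists>k<length \<pi>. h i = (Suc k, \<pi> ! k)" if "i < length \<sigma>" for i
    using P[OF that] assms unfolding order_emb_def h_def points_image[of \<pi>] by blast
  have hx: "fst (h i) < fst (h j) \<longleftrightarrow> i < j" and hy: "snd (h i) < snd (h j) \<longleftrightarrow> \<sigma> ! i < \<sigma> ! j"
    if "i < length \<sigma>" "j < length \<sigma>" for i j
    using P[OF that(1)] P[OF that(2)] assms unfolding order_emb_def h_def by fastforce+
  have nth: "\<pi> ! (js ! i) = snd (h i)" "js ! i < length \<pi>" "fst (h i) = Suc (js ! i)" if "i < length \<sigma>" for i
    using h[OF that] that by (auto simp: js_def)
  have len: "length js = length \<sigma>" by (simp add: js_def)
  have "sorted_wrt (<) js"
    unfolding sorted_wrt_iff_nth_less using hx nth(3) by (auto simp: len)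
  moreover have "set js \<subseteq> {..<length \<pi>}"
    unfolding set_conv_nth using nth(2) len by auto
  ultimately have "subseq (map ((!) \<pi>) js) \<pi>" using subseq_iff_indices by blast
  moreover have "order_isomorphic \<sigma> (map ((!) \<pi>) js)"
    unfolding order_isomorphic_def using hy nth(1) by (simp add: len)
  ultimately show ?thesis unfolding perm_contained_def by blast
qed

lemma contained_imp_order_emb_points:
  assumes "\<sigma> \<preceq> \<pi>"
  shows "\<exists>f. order_emb f (points \<sigma>) (points \<pi>)"
proof -
  obtain ys where ys: "subseq ys \<pi>" "order_isomorphic \<sigma> ys" using assms unfolding perm_contained_def by blast
  then obtain js where js: "sorted_wrt (<) js" "set js \<subseteq> {..<length \<pi>}" "ys = map ((!) \<pi>) js"
    using subseq_iff_indices by blast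
  have len: "length js = length \<sigma>" using ys(2) js(3) by (simp add: order_isomorphic_def)
  define f :: "nat \<times> nat \<Rightarrow> nat \<times> nat" where "f p = (Suc (js ! (fst p - 1)), \<pi> ! (js ! (fst p - 1)))" for p
  have "order_emb f (points \<sigma>) (points \<pi>)"
    unfolding order_emb_def points_image
  proof (intro conjI ballI)
    show "f ` (\<lambda>i. (Suc i, \<sigma> ! i)) ` {..<length \<sigma>} \<subseteq> (\<lambda>i. (Suc i, \<pi> ! i)) ` {..<length \<pi>}"
    proof (rule subsetI)
      fix p assume "p \<in> f ` (\<lambda>i. (Suc i, \<sigma> ! i)) ` {..<length \<sigma>}"
      then obtain i where i: "i < length \<sigma>" "p = f (Suc i, \<sigma> ! i)" by blast
      then have "js ! i < length \<pi>" using js(2) len by (metis lessThan_iff nth_mem subsetD)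
      then show "p \<in> (\<lambda>i. (Suc i, \<pi> ! i)) ` {..<length \<pi>}" by (simp add: f_def i(2))
    qed
    fix p q assume "p \<in> (\<lambda>i. (Suc i, \<sigma> ! i)) ` {..<length \<sigma>}" "q \<in> (\<lambda>i. (Suc i, \<sigma> ! i)) ` {..<length \<sigma>}"
    then obtain i j where ij: "i < length \<sigma>" "p = (Suc i, \<sigma> ! i)" "j < length \<sigma>" "q = (Suc j, \<sigma> ! j)" by blast
    show "(fst p < fst q) = (fst (f p) < fst (f q))"
      using ij len sorted_wrt_less_nth_iff[OF js(1)] by (simp add: f_def)
    show "(snd p < snd q) = (snd (f p) < snd (f q))"
      using ij len ys(2) by (simp add: f_def order_isomorphic_def js(3))
  qed
  then show ?thesis by blast
qed

text \<open>Sort the points by abscissa and replace each height by its rank.\<close>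

lemma standardization:
  assumes "generic F"
  shows "\<exists>\<sigma>\<in>perms. \<exists>g. order_emb g (points \<sigma>) F \<and> bij_betw g (points \<sigma>) F"
proof -
  have fin: "finite F" and inj: "inj_on fst F" "inj_on snd F" using assms by (auto simp: generic_def)
  define xs where "xs = sorted_list_of_set (fst ` F)"
  define ps where "ps = map (inv_into F fst) xs"
  have xs: "set xs = fst ` F" "sorted_wrt (<) xs" "distinct xs" "length xs = card F"
    using fin inj by (auto simp: xs_def card_image)
  have len: "length ps = card F" by (simp add: ps_def xs(4))
  have fst_ps: "map fst ps = xs" using xs(1) by (auto simp: ps_def f_inv_into_f intro: map_idI)
  have set_ps: "set ps = F" using inj(1) by (auto simp: ps_def xs(1) image_comp)
  have dist: "distinct ps" using xs(3) fst_ps distinct_map by metis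
  define V where "V = snd ` F"
  have V: "finite V" "card V = card F" using fin inj by (auto simp: V_def card_image)
  \<comment> \<open>Counting with \<le> makes the ranks start at 1, as \<open>perms\<close>
    requires.\<close>
  define r where "r v = card {u \<in> V. u \<le> v}" for v
  have r_mono: "r v < r w" if "v < w" "w \<in> V" for v w
  proof -
    have "w \<in> {u \<in> V. u \<le> w}" "w \<notin> {u \<in> V. u \<le> v}" "{u \<in> V. u \<le> v} \<subseteq> {u \<in> V. u \<le> w}"
      using that by auto
    then have "{u \<in> V. u \<le> v} \<subset> {u \<in> V. u \<le> w}" by blast
    then show ?thesis unfolding r_def using V by (intro psubset_card_mono) auto
  qed
  have r_iff: "r v < r w \<longleftrightarrow> v < w" if "v \<in> V" "w \<in> V" for v w
    using r_mono that by (metis linorder_neqE_nat less_asym' less_irrefl)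
  have r_inj: "inj_on r V"
  proof (rule inj_onI)
    fix v w assume "v \<in> V" "w \<in> V" "r v = r w"
    then show "v = w" using r_iff[of v w] r_iff[of w v] by auto
  qed
  have "r ` V \<subseteq> {1..card F}"
  proof clarify
    fix v assume "v \<in> V"
    then have "{u \<in> V. u \<le> v} \<noteq> {}" by blast
    then have "0 < r v" using V by (auto simp: r_def card_gt_0_iff)
    moreover have "r v \<le> card F" unfolding r_def V(2)[symmetric] using V by (intro card_mono) auto
    ultimately show "r v \<in> {1..card F}" by simp
  qed
  moreover have "card (r ` V) = card F" using r_inj V by (simp add: card_image)
  ultimately have rV: "r ` V = {1..card F}" by (intro card_subset_eq) auto
  define \<sigma> where "\<sigma> = map (\<lambda>p. r (snd p)) ps"
  have len\<sigma>: "length \<sigma> = card F" by (simp add: \<sigma>_def len)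
  have "set \<sigma> = r ` V" by (auto simp: \<sigma>_def set_ps V_def)
  then have "set \<sigma> = {1..length \<sigma>}" using rV by (simp add: len\<sigma>)
  moreover from this have "distinct \<sigma>" by (intro card_distinct) simp
  ultimately have "\<sigma> \<in> perms" by (simp add: mem_perms_iff)
  define g where "g p = ps ! (fst p - 1)" for p :: "nat \<times> nat"
  have psF: "ps ! i \<in> F" if "i < card F" for i using that set_ps len nth_mem by metis
  have "order_emb g (points \<sigma>) F"
    unfolding order_emb_def points_image
  proof (intro conjI ballI)
    show "g ` (\<lambda>i. (Suc i, \<sigma> ! i)) ` {..<length \<sigma>} \<subseteq> F" using psF by (auto simp: g_def len\<sigma>)
    fix p q assume "p \<in> (\<lambda>i. (Suc i, \<sigma> ! i)) ` {..<length \<sigma>}" "q \<in> (\<lambda>i. (Suc i, \<sigma> ! i)) ` {..<length \<sigma>}"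
    then obtain i j where ij: "i < card F" "p = (Suc i, \<sigma> ! i)" "j < card F" "q = (Suc j, \<sigma> ! j)"
      by (auto simp: len\<sigma>)
    have fx: "fst (ps ! i) = xs ! i" "fst (ps ! j) = xs ! j" using ij len by (simp_all flip: fst_ps)
    show "(fst p < fst q) = (fst (g p) < fst (g q))"
      using ij fx sorted_wrt_less_nth_iff[OF xs(2), of i j] xs(4) by (simp add: g_def)
    have "snd (ps ! i) \<in> V" "snd (ps ! j) \<in> V" using psF ij by (auto simp: V_def)
    then show "(snd p < snd q) = (snd (g p) < snd (g q))"
      using ij r_iff len by (simp add: g_def \<sigma>_def)
  qed
  moreover have "bij_betw g (points \<sigma>) F"
  proof -
    have "g ` points \<sigma> = F"
    proof -
      have "g ` points \<sigma> = (!) ps ` {..<length ps}" by (auto simp: points_image g_def image_image len len\<sigma>)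
      also have "\<dots> = F" using set_ps by (metis lessThan_atLeast0 list.set_map map_nth set_upt)
      finally show ?thesis .
    qed
    moreover have "inj_on g (points \<sigma>)"
      using dist len len\<sigma> by (auto simp: inj_on_def points_image g_def nth_eq_iff_index_eq)
    ultimately show ?thesis by (simp add: bij_betw_def)
  qed
  ultimately show ?thesis using \<open>\<sigma> \<in> perms\<close> by blast
qed

lemma fst_inversion_graph: "fst (inversion_graph \<pi>) = points \<pi>"
  by (simp add: inversion_graph_def)

lemma edge_inversion_graph:
  "{p, q} \<in> snd (inversion_graph \<pi>) \<longleftrightarrow> p \<in> points \<pi> \<and> q \<in> points \<pi> \<and> inversion p q"
proof
  assume "{p, q} \<in> snd (inversion_graph \<pi>)"
  then obtain i a j b where "{p, q} = {(i, a), (j, b)}" "(i, a) \<in> points \<pi>" "(j, b) \<in> points \<pi>" "i < j" "a > b"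
    unfolding inversion_graph_def by auto
  then show "p \<in> points \<pi> \<and> q \<in> points \<pi> \<and> inversion p q"
    unfolding doubleton_eq_iff inversion_def by auto
next
  have edge: "{p, q} \<in> snd (inversion_graph \<pi>)"
    if "p \<in> points \<pi>" "q \<in> points \<pi>" "fst p < fst q" "snd q < snd p" for p q
  proof -
    have "{p, q} = {(fst p, snd p), (fst q, snd q)}" by simp
    then show ?thesis using that unfolding inversion_graph_def snd_conv mem_Collect_eq by (metis prod.collapse)
  qed
  assume "p \<in> points \<pi> \<and> q \<in> points \<pi> \<and> inversion p q"
  then show "{p, q} \<in> snd (inversion_graph \<pi>)"
    using edge[of p q] edge[of q p] unfolding inversion_def by (metis insert_commute)
qed

lemmas inversion_graph_simps = fst_inversion_graph edge_inversion_graph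

text \<open>An entry of a permutation is one more than the number of smaller entries, and order
  isomorphism preserves that number.\<close>

lemma perm_eqI_order_isomorphic:
  assumes "\<sigma> \<in> perms" "\<pi> \<in> perms" "order_isomorphic \<sigma> \<pi>"
  shows "\<sigma> = \<pi>"
proof -
  have rank: "card {j \<in> {..<length \<rho>}. \<rho> ! j < \<rho> ! i} = \<rho> ! i - 1" if "\<rho> \<in> perms" "i < length \<rho>" for \<rho> i
  proof -
    have d: "distinct \<rho>" "set \<rho> = {1..length \<rho>}" using that by (auto simp: mem_perms_iff)
    have le: "\<rho> ! i \<le> length \<rho>" using d(2) nth_mem[OF that(2)] by auto
    have "(!) \<rho> ` {j \<in> {..<length \<rho>}. \<rho> ! j < \<rho> ! i} = {v \<in> set \<rho>. v < \<rho> ! i}"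
      by (auto simp: set_conv_nth)
    also have "\<dots> = {1..<\<rho> ! i}" using le unfolding d(2) by auto
    finally have "card ((!) \<rho> ` {j \<in> {..<length \<rho>}. \<rho> ! j < \<rho> ! i}) = \<rho> ! i - 1" by simp
    moreover have "inj_on ((!) \<rho>) {j \<in> {..<length \<rho>}. \<rho> ! j < \<rho> ! i}"
      using d(1) by (auto simp: inj_on_def nth_eq_iff_index_eq)
    ultimately show ?thesis by (simp add: card_image)
  qed
  have pos: "\<rho> ! i \<ge> 1" if "\<rho> \<in> perms" "i < length \<rho>" for \<rho> i
    using that nth_mem[OF that(2)] by (auto simp: mem_perms_iff)
  have len: "length \<sigma> = length \<pi>" using assms(3) by (simp add: order_isomorphic_def)
  show ?thesis
  proof (rule nth_equalityI[OF len])
    fix i assume i: "i < length \<sigma>"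
    have "{j \<in> {..<length \<sigma>}. \<sigma> ! j < \<sigma> ! i} = {j \<in> {..<length \<pi>}. \<pi> ! j < \<pi> ! i}"
      using assms(3) i len by (auto simp: order_isomorphic_def)
    from arg_cong[OF this, of card] have "\<sigma> ! i - 1 = \<pi> ! i - 1"
      unfolding rank[OF assms(1) i] rank[OF assms(2) i[unfolded len]] .
    then show "\<sigma> ! i = \<pi> ! i" using pos[OF assms(1) i] pos[OF assms(2), of i] i len by simp
  qed
qed

lemma contained_same_length_imp_eq:
  assumes "\<sigma> \<in> perms" "\<pi> \<in> perms" "\<sigma> \<preceq> \<pi>" "length \<sigma> = length \<pi>"
  shows "\<sigma> = \<pi>"
proof -
  obtain ys where ys: "subseq ys \<pi>" "order_isomorphic \<sigma> ys" using assms(3) unfolding perm_contained_def by blast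
  then have "ys = \<pi>" using assms(4) by (simp add: order_isomorphic_def subseq_same_length)
  then show ?thesis using perm_eqI_order_isomorphic assms ys by blast
qed

section \<open>Double-ended forks\<close>

abbreviation fork_edge :: "nat \<Rightarrow> nat \<Rightarrow> nat \<Rightarrow> bool" where
  "fork_edge n i j \<equiv> {i, j} \<in> snd (double_ended_fork n)"

text \<open>An induced copy of the fork, stated for point sets so that it makes sense for
  components, whose coordinates need not be those of a permutation.\<close>

definition has_fork :: "(nat \<times> nat) set \<Rightarrow> nat \<Rightarrow> bool" where
  "has_fork S n \<longleftrightarrow> (\<exists>v. inj_on v {..<n + 4} \<and> v ` {..<n + 4} \<subseteq> S \<and>
     (\<forall>i<n + 4. \<forall>j<n + 4. inversion (v i) (v j) \<longleftrightarrow> fork_edge n i j))"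

text \<open>Standardizing the \<open>n + 4\<close> points of the copy preserves inversions. This
  turns forks among points into members of \<open>fork_perms\<close> that a class inherits.\<close>

lemma has_fork_imp_fork_perm:
  assumes "generic (points \<pi>)" "has_fork (points \<pi>) n" "n \<ge> 2"
  shows "\<exists>\<sigma>\<in>fork_perms. \<sigma> \<preceq> \<pi> \<and> length \<sigma> = n + 4"
proof -
  obtain v where v: "inj_on v {..<n + 4}" "v ` {..<n + 4} \<subseteq> points \<pi>"
    "\<And>i j. i < n + 4 \<Longrightarrow> j < n + 4 \<Longrightarrow> inversion (v i) (v j) \<longleftrightarrow> fork_edge n i j"
    using assms(2) unfolding has_fork_def by blast
  define F where "F = v ` {..<n + 4}"
  have "generic F" using generic_subset assms(1) v(2) by (simp add: F_def)
  then obtain \<sigma> g where \<sigma>: "\<sigma> \<in> perms" "order_emb g (points \<sigma>) F" "bij_betw g (points \<sigma>) F"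
    using standardization by blast
  define f where "f = inv_into {..<n + 4} v \<circ> g"
  have vbij: "bij_betw v {..<n + 4} F" using v(1) by (simp add: F_def bij_betw_def)
  have f: "bij_betw f (points \<sigma>) {..<n + 4}"
    unfolding f_def by (rule bij_betw_trans[OF \<sigma>(3) bij_betw_inv_into[OF vbij]])
  have fv: "v (f p) = g p" "f p < n + 4" if "p \<in> points \<sigma>" for p
  proof -
    have "g p \<in> F" using \<sigma>(3) that bij_betwE by blast
    then show "v (f p) = g p" by (auto simp: f_def F_def f_inv_into_f)
    show "f p < n + 4" using bij_betwE[OF f] that by auto
  qed
  have "graph_isomorphic (inversion_graph \<sigma>) (double_ended_fork n)"
    unfolding graph_isomorphic_def
  proof (intro exI[of _ f] conjI ballI)
    show "bij_betw f (fst (inversion_graph \<sigma>)) (fst (double_ended_fork n))"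
      using f by (simp add: inversion_graph_simps double_ended_fork_def)
    fix p q assume "p \<in> fst (inversion_graph \<sigma>)" "q \<in> fst (inversion_graph \<sigma>)"
    then have pq: "p \<in> points \<sigma>" "q \<in> points \<sigma>" by (simp_all add: inversion_graph_simps)
    then have "{p, q} \<in> snd (inversion_graph \<sigma>) \<longleftrightarrow> inversion (g p) (g q)"
      using order_emb_inversion[OF \<sigma>(2)] by (simp add: inversion_graph_simps)
    also have "\<dots> \<longleftrightarrow> fork_edge n (f p) (f q)" using v(3)[of "f p" "f q"] fv pq by simp
    finally show "{p, q} \<in> snd (inversion_graph \<sigma>) \<longleftrightarrow> fork_edge n (f p) (f q)" .
  qed
  then have "\<sigma> \<in> fork_perms" using \<sigma>(1) assms(3) unfolding fork_perms_def by blast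
  moreover have "\<sigma> \<preceq> \<pi>"
    using order_emb_points_imp_contained order_emb_mono[OF \<sigma>(2)] v(2) F_def by blast
  moreover have "length \<sigma> = n + 4" using bij_betw_same_card[OF f] by (simp add: card_points)
  ultimately show ?thesis by blast
qed

lemma fork_edge_iff:
  assumes "n \<ge> 2"
  shows "fork_edge n i j \<longleftrightarrow>
    (i < n \<and> j < n \<and> (j = Suc i \<or> i = Suc j)) \<or>
    (i = 0 \<and> (j = n \<or> j = n + 1)) \<or> (j = 0 \<and> (i = n \<or> i = n + 1)) \<or>
    (i = n - 1 \<and> (j = n + 2 \<or> j = n + 3)) \<or> (j = n - 1 \<and> (i = n + 2 \<or> i = n + 3))"
proof -
  have path: "{i, j} \<in> {{k, k + 1} |k. k + 1 < n} \<longleftrightarrow> i < n \<and> j < n \<and> (j = Suc i \<or> i = Suc j)"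
    by (auto simp: doubleton_eq_iff)
  show ?thesis
    unfolding double_ended_fork_def snd_conv Un_iff path insert_iff empty_iff doubleton_eq_iff by blast
qed

lemma fork_embedding_le:
  assumes n: "n \<ge> 2" and m: "m \<ge> 2"
    and inj: "inj_on \<phi> {..<n + 4}"
    and edge: "\<And>i j. i < n + 4 \<Longrightarrow> j < n + 4 \<Longrightarrow> fork_edge n i j \<Longrightarrow> fork_edge m (\<phi> i) (\<phi> j)"
  shows "m \<le> n"
proof -
  \<comment> \<open>Retraction onto the path: a leaf is sent to the end it hangs from, so every edge
    changes the position by at most one.\<close>
  define pos :: "nat \<Rightarrow> int" where "pos k = (if k < m then int k else if k < m + 2 then 0 else int m - 1)" for k
  have pos_edge: "\<bar>pos a - pos b\<bar> \<le> 1" if "fork_edge m a b" for a b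
    using that m unfolding fork_edge_iff[OF m] pos_def by auto
  have deg3: "a = 0 \<or> a = m - 1"
    if "fork_edge m a b" "fork_edge m a c" "fork_edge m a d" "b \<noteq> c" "b \<noteq> d" "c \<noteq> d" for a b c d
    using that m unfolding fork_edge_iff[OF m] by auto
  have ne: "\<phi> i \<noteq> \<phi> j" if "i < n + 4" "j < n + 4" "i \<noteq> j" for i j
    using inj that by (auto simp: inj_on_def)
  have "\<phi> 0 = 0 \<or> \<phi> 0 = m - 1"
    by (rule deg3[of _ "\<phi> 1" "\<phi> n" "\<phi> (n + 1)"]; (intro edge ne)?) (use n in \<open>auto simp: fork_edge_iff[OF n]\<close>)
  moreover have "\<phi> (n - 1) = 0 \<or> \<phi> (n - 1) = m - 1"
    by (rule deg3[of _ "\<phi> (n - 2)" "\<phi> (n + 2)" "\<phi> (n + 3)"]; (intro edge ne)?)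
      (use n in \<open>auto simp: fork_edge_iff[OF n]\<close>)
  moreover have "\<phi> 0 \<noteq> \<phi> (n - 1)" using n by (intro ne) auto
  ultimately have far: "\<bar>pos (\<phi> (n - 1)) - pos (\<phi> 0)\<bar> = int m - 1" using m by (auto simp: pos_def)
  have "\<bar>pos (\<phi> i) - pos (\<phi> 0)\<bar> \<le> int i" if "i < n" for i
    using that
  proof (induction i)
    case (Suc i)
    have "fork_edge m (\<phi> i) (\<phi> (Suc i))" using Suc.prems by (intro edge) (auto simp: fork_edge_iff[OF n])
    from pos_edge[OF this] show ?case using Suc by simp
  qed simp
  from this[of "n - 1"] show ?thesis using far n by simp
qed

text \<open>Counting points gives \<open>n \<le> m\<close>, comparing the distances of the
  degree-three vertices gives \<open>m \<le> n\<close>, and containment at equal length is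
  equality.\<close>

lemma fork_perms_antichain:
  assumes "\<sigma> \<in> fork_perms" "\<pi> \<in> fork_perms" "\<sigma> \<preceq> \<pi>"
  shows "\<sigma> = \<pi>"
proof -
  obtain n f where n: "n \<ge> 2" "bij_betw f (points \<sigma>) {..<n + 4}"
    "\<And>p q. p \<in> points \<sigma> \<Longrightarrow> q \<in> points \<sigma> \<Longrightarrow> inversion p q \<longleftrightarrow> fork_edge n (f p) (f q)"
    using assms(1) unfolding fork_perms_def graph_isomorphic_def
    by (auto simp: inversion_graph_simps) (auto simp: double_ended_fork_def)
  obtain m g where m: "m \<ge> 2" "bij_betw g (points \<pi>) {..<m + 4}"
    "\<And>p q. p \<in> points \<pi> \<Longrightarrow> q \<in> points \<pi> \<Longrightarrow> inversion p q \<longleftrightarrow> fork_edge m (g p) (g q)"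
    using assms(2) unfolding fork_perms_def graph_isomorphic_def
    by (auto simp: inversion_graph_simps) (auto simp: double_ended_fork_def)
  have perms: "\<sigma> \<in> perms" "\<pi> \<in> perms" using assms by (auto simp: fork_perms_def)
  obtain h where h: "order_emb h (points \<sigma>) (points \<pi>)" using contained_imp_order_emb_points assms(3) by blast
  have hpts: "h ` points \<sigma> \<subseteq> points \<pi>" using h by (simp add: order_emb_def)
  have hinj: "inj_on h (points \<sigma>)" using order_emb_inj h generic_points perms(1) mem_perms_iff by blast
  define f' where "f' = inv_into (points \<sigma>) f"
  have f': "bij_betw f' {..<n + 4} (points \<sigma>)" using bij_betw_inv_into n(2) f'_def by blast
  have ff': "f (f' i) = i" "f' i \<in> points \<sigma>" if "i < n + 4" for i
    using that n(2) f' bij_betw_inv_into_right[OF n(2)] bij_betwE[OF f'] by (auto simp: f'_def)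
  have len: "length \<sigma> = n + 4" "length \<pi> = m + 4"
    using bij_betw_same_card[OF n(2)] bij_betw_same_card[OF m(2)] by (simp_all add: card_points)
  have "length \<sigma> \<le> length \<pi>"
    using card_inj_on_le[OF hinj hpts] generic_points perms(2) by (simp add: card_points generic_def mem_perms_iff)
  moreover have "m \<le> n"
  proof (rule fork_embedding_le[OF n(1) m(1)])
    show "inj_on (g \<circ> h \<circ> f') {..<n + 4}"
      using f' hinj hpts m(2) by (intro comp_inj_on) (auto simp: bij_betw_def inj_on_subset)
    fix i j assume "i < n + 4" "j < n + 4" "fork_edge n i j"
    then have "inversion (f' i) (f' j)" using n(3)[of "f' i" "f' j"] ff' by simp
    then have "inversion (h (f' i)) (h (f' j))" using order_emb_inversion[OF h] ff' \<open>i < n + 4\<close> \<open>j < n + 4\<close> by simp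
    then show "fork_edge m ((g \<circ> h \<circ> f') i) ((g \<circ> h \<circ> f') j)"
      using m(3)[of "h (f' i)" "h (f' j)"] hpts ff' \<open>i < n + 4\<close> \<open>j < n + 4\<close> by auto
  qed
  ultimately show ?thesis using contained_same_length_imp_eq perms assms(3) len by simp
qed

section \<open>Sums of point sets and words over the staircase\<close>

definition below :: "(nat \<times> nat) set \<Rightarrow> (nat \<times> nat) set \<Rightarrow> bool" where
  "below A B \<longleftrightarrow> (\<forall>a\<in>A. \<forall>b\<in>B. fst a < fst b \<and> snd a < snd b)"

definition embeds :: "(nat \<times> nat) set \<Rightarrow> (nat \<times> nat) set \<Rightarrow> bool" where
  "embeds S T \<longleftrightarrow> (\<exists>f. order_emb f S T)"

fun sum_of :: "(nat \<times> nat) set list \<Rightarrow> (nat \<times> nat) set \<Rightarrow> bool" where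
  "sum_of [] S \<longleftrightarrow> S = {}"
| "sum_of (A # As) S \<longleftrightarrow> (\<exists>B. S = A \<union> B \<and> below A B \<and> sum_of As B)"

lemma embeds_union:
  assumes "embeds A A'" "embeds B B'" "below A B" "below A' B'"
  shows "embeds (A \<union> B) (A' \<union> B')"
proof -
  obtain f g where f: "order_emb f A A'" and g: "order_emb g B B'" using assms unfolding embeds_def by blast
  define h where "h p = (if p \<in> A then f p else g p)" for p
  have B: "p \<notin> A" if "p \<in> B" for p using that assms(3) unfolding below_def by blast
  have ff: "h ` (A \<union> B) \<subseteq> A' \<union> B'" using f g by (auto simp: order_emb_def h_def)
  have AB: "fst (h p) < fst (h q) \<and> snd (h p) < snd (h q) \<and> fst p < fst q \<and> snd p < snd q"
    if "p \<in> A" "q \<in> B" for p q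
  proof -
    have "h p \<in> A'" "h q \<in> B'" using that f g B by (auto simp: h_def order_emb_def)
    then show ?thesis using that assms(3,4) by (auto simp: below_def)
  qed
  have "order_emb h (A \<union> B) (A' \<union> B')"
    unfolding order_emb_def
  proof (intro conjI ff ballI)
    fix p q assume pq: "p \<in> A \<union> B" "q \<in> A \<union> B"
    have "(fst p < fst q \<longleftrightarrow> fst (h p) < fst (h q)) \<and> (snd p < snd q \<longleftrightarrow> snd (h p) < snd (h q))"
    proof (cases "p \<in> A"; cases "q \<in> A")
      assume "p \<in> A" "q \<in> A"
      then show ?thesis using f by (simp add: order_emb_def h_def)
    next
      assume "p \<in> A" "q \<notin> A"
      then show ?thesis using AB[of p q] pq by blast
    next
      assume "p \<notin> A" "q \<in> A"
      then show ?thesis using AB[of q p] pq by (meson UnE less_asym)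
    next
      assume "p \<notin> A" "q \<notin> A"
      then show ?thesis using g pq by (simp add: order_emb_def h_def)
    qed
    then show "(fst p < fst q) = (fst (h p) < fst (h q))" "(snd p < snd q) = (snd (h p) < snd (h q))" by blast+
  qed
  then show ?thesis unfolding embeds_def by blast
qed

text \<open>Points of different summands are always in increasing position, so embeddings of the
  summands glue; summands of the target skipped by \<open>list_emb\<close> are not hit.\<close>

lemma sum_of_embeds:
  assumes "list_emb embeds As Bs" "sum_of As S" "sum_of Bs T"
  shows "embeds S T"
  using assms
proof (induction As Bs arbitrary: S T rule: list_emb.induct)
  case (list_emb_Nil Bs)
  then show ?case by (simp add: embeds_def order_emb_def)
next
  case (list_emb_Cons As Bs B)
  then obtain T' where "T = B \<union> T'" "sum_of Bs T'" by auto
  then show ?case using list_emb_Cons.IH[OF list_emb_Cons.prems(1)] order_emb_mono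
    unfolding embeds_def by (metis Un_upper2)
next
  case (list_emb_Cons2 A B As Bs)
  then obtain S' T' where "T = B \<union> T'" "below B T'" "sum_of Bs T'" "S = A \<union> S'" "below A S'" "sum_of As S'"
    by auto
  then show ?case using list_emb_Cons2.IH list_emb_Cons2.hyps embeds_union by blast
qed

section \<open>Words over the staircase and the subword order\<close>

definition lex_less :: "int \<Rightarrow> nat \<Rightarrow> int \<Rightarrow> nat \<Rightarrow> bool" where
  "lex_less a i b j \<longleftrightarrow> a < b \<or> (a = b \<and> i < j)"

text \<open>
  Cell \<open>c\<close> of the infinite staircase lies in column \<open>(c + 1) div 2\<close> and row \<open>c div 2\<close>. The \<open>i\<close>-th
  letter of a word puts a point at height \<open>i\<close> on the diagonal of its cell.
\<close>

definition encodes :: "int list \<Rightarrow> (nat \<times> nat) set \<Rightarrow> bool" where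
  "encodes w S \<longleftrightarrow> (\<exists>ps. set ps = S \<and> distinct ps \<and> length ps = length w \<and>
     (\<forall>i<length w. \<forall>j<length w.
        (fst (ps ! i) < fst (ps ! j) \<longleftrightarrow> lex_less ((w ! i + 1) div 2) i ((w ! j + 1) div 2) j) \<and>
        (snd (ps ! i) < snd (ps ! j) \<longleftrightarrow> lex_less (w ! i div 2) i (w ! j div 2) j)))"

text \<open>The relative position of two points depends only on their two letters and on which
  letter comes first; passing to a subword changes neither.\<close>

lemma encodes_subseq_embeds:
  assumes "encodes w S" "encodes w' S'" "subseq w w'"
  shows "embeds S S'"
proof -
  obtain ps where ps: "set ps = S" "distinct ps" "length ps = length w"
    and ord: "\<And>i j. i < length w \<Longrightarrow> j < length w \<Longrightarrow>
        (fst (ps ! i) < fst (ps ! j) \<longleftrightarrow> lex_less ((w ! i + 1) div 2) i ((w ! j + 1) div 2) j) \<and>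
        (snd (ps ! i) < snd (ps ! j) \<longleftrightarrow> lex_less (w ! i div 2) i (w ! j div 2) j)"
    using assms(1) unfolding encodes_def by blast
  obtain ps' where ps': "set ps' = S'" "length ps' = length w'"
    and ord': "\<And>i j. i < length w' \<Longrightarrow> j < length w' \<Longrightarrow>
        (fst (ps' ! i) < fst (ps' ! j) \<longleftrightarrow> lex_less ((w' ! i + 1) div 2) i ((w' ! j + 1) div 2) j) \<and>
        (snd (ps' ! i) < snd (ps' ! j) \<longleftrightarrow> lex_less (w' ! i div 2) i (w' ! j div 2) j)"
    using assms(2) unfolding encodes_def by blast
  obtain js where js: "sorted_wrt (<) js" "set js \<subseteq> {..<length w'}" "w = map ((!) w') js"
    using assms(3) subseq_iff_indices by blast
  have len: "length js = length w" by (simp add: js(3))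
  have jlt: "js ! i < length w'" if "i < length w" for i
  proof -
    have "js ! i \<in> set js" using that len by simp
    then show ?thesis using js(2) by blast
  qed
  have wj: "w ! i = w' ! (js ! i)" if "i < length w" for i using that by (simp add: js(3))
  have jiff: "js ! i < js ! j \<longleftrightarrow> i < j" if "i < length w" "j < length w" for i j
    using sorted_wrt_less_nth_iff[OF js(1)] that len by simp
  define idx where "idx = inv_into {..<length w} ((!) ps)"
  have idx: "idx p < length w" "ps ! idx p = p" if "p \<in> S" for p
  proof -
    have "p \<in> (!) ps ` {..<length w}" using that ps(1,3) by (auto simp: in_set_conv_nth)
    from inv_into_into[OF this] f_inv_into_f[OF this]
    show "idx p < length w" "ps ! idx p = p" by (simp_all add: idx_def)
  qed
  define f where "f p = ps' ! (js ! idx p)" for p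
  have "order_emb f S S'"
    unfolding order_emb_def
  proof (intro conjI ballI)
    show "f ` S \<subseteq> S'" using idx jlt ps' by (auto simp: f_def)
    fix p q assume pq: "p \<in> S" "q \<in> S"
    let ?i = "idx p" and ?j = "idx q"
    have lt: "?i < length w" "?j < length w" using idx pq by auto
    note o = ord[OF lt] and o' = ord'[OF jlt[OF lt(1)] jlt[OF lt(2)]]
    have "(fst (ps ! ?i) < fst (ps ! ?j) \<longleftrightarrow> fst (ps' ! (js ! ?i)) < fst (ps' ! (js ! ?j)))
        \<and> (snd (ps ! ?i) < snd (ps ! ?j) \<longleftrightarrow> snd (ps' ! (js ! ?i)) < snd (ps' ! (js ! ?j)))"
      using o o' jiff[OF lt] wj[OF lt(1)] wj[OF lt(2)] by (simp add: lex_less_def)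
    then show "(fst p < fst q) = (fst (f p) < fst (f q))" "(snd p < snd q) = (snd (f p) < snd (f q))"
      using idx(2) pq by (simp_all add: f_def)
  qed
  then show ?thesis unfolding embeds_def by blast
qed

text \<open>Shifting by \<open>2 * k\<close> cells adds \<open>k\<close> to every column and every
  row. An odd shift would exchange the roles of columns and rows.\<close>

lemma encodes_shift:
  assumes "encodes (map (\<lambda>c. c + 2 * k) w) S"
  shows "encodes w S"
proof -
  have "(c + 2 * k + 1) div 2 = (c + 1) div 2 + k" "(c + 2 * k) div 2 = c div 2 + k" for c by simp_all
  then show ?thesis using assms unfolding encodes_def by (auto simp: lex_less_def)
qed

text \<open>Different columns or rows already decide the order, so the listing only has to respect
  pairs that share one. One-way implications suffice because \<open>lex_less\<close> is linear on
  distinct positions.\<close>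

lemma encodes_intro:
  fixes cell :: "nat \<times> nat \<Rightarrow> int"
  assumes "set ps = S" "distinct ps" "generic S"
    and col: "\<And>p q. p \<in> S \<Longrightarrow> q \<in> S \<Longrightarrow> (cell p + 1) div 2 < (cell q + 1) div 2 \<Longrightarrow> fst p < fst q"
    and row: "\<And>p q. p \<in> S \<Longrightarrow> q \<in> S \<Longrightarrow> cell p div 2 < cell q div 2 \<Longrightarrow> snd p < snd q"
    and sorted: "sorted_wrt (\<lambda>p q. ((cell p + 1) div 2 = (cell q + 1) div 2 \<longrightarrow> fst p < fst q) \<and>
      (cell p div 2 = cell q div 2 \<longrightarrow> snd p < snd q)) ps"
  shows "encodes (map cell ps) S"
proof -
  have lt: "fst (ps ! i) < fst (ps ! j)" if "lex_less ((cell (ps ! i) + 1) div 2) i ((cell (ps ! j) + 1) div 2) j"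
    "i < length ps" "j < length ps" for i j
    using that col[of "ps ! i" "ps ! j"] sorted_wrt_nth_less[OF sorted, of i j] assms(1)
    by (auto simp: lex_less_def)
  have lt': "snd (ps ! i) < snd (ps ! j)" if "lex_less (cell (ps ! i) div 2) i (cell (ps ! j) div 2) j"
    "i < length ps" "j < length ps" for i j
    using that row[of "ps ! i" "ps ! j"] sorted_wrt_nth_less[OF sorted, of i j] assms(1)
    by (auto simp: lex_less_def)
  have lin: "lex_less a i b j \<or> lex_less b j a i \<or> i = j" for a b i j by (auto simp: lex_less_def)
  have "(fst (ps ! i) < fst (ps ! j) \<longleftrightarrow> lex_less ((cell (ps ! i) + 1) div 2) i ((cell (ps ! j) + 1) div 2) j) \<and>
    (snd (ps ! i) < snd (ps ! j) \<longleftrightarrow> lex_less (cell (ps ! i) div 2) i (cell (ps ! j) div 2) j)"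
    if "i < length ps" "j < length ps" for i j
    using lt[OF _ that] lt[OF _ that(2,1)] lt'[OF _ that] lt'[OF _ that(2,1)] lin less_asym less_irrefl by metis
  then show ?thesis unfolding encodes_def using assms(1,2) by (intro exI[of _ ps]) auto
qed

text \<open>
  An arbitrary word \<open>u\<close> over a window of cells, continued by \<open>m\<close> one-point cells above the window
  and \<open>a\<close> one-point cells below it.
\<close>

definition path_word :: "int \<Rightarrow> nat \<Rightarrow> int list \<Rightarrow> nat \<Rightarrow> nat \<Rightarrow> int list" where
  "path_word l N u a m =
     rev (map (\<lambda>i. l + int N + 1 + int i) [0..<m]) @ u @ map (\<lambda>i. l - 1 - int i) [0..<a]"

text \<open>An even shift brings the start of any window to 0 or 1; the letters of the lower run may
  then be negative.\<close>

definition path_words :: "nat \<Rightarrow> int list set" where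
  "path_words N = {path_word l N u a m | l u a m. l \<in> {0, 1} \<and> set u \<subseteq> {l..l + int N}}"

text \<open>Lengthening a run only adds letters at the outer end of the word: in front for the upper
  run, at the back for the lower one.\<close>

lemma path_word_subseq:
  assumes "subseq u u'" "a \<le> a'" "m \<le> m'"
  shows "subseq (path_word l N u a m) (path_word l N u' a' m')"
proof -
  have split: "map f [0..<k'] = map f [0..<k] @ map f [k..<k']" if "k \<le> k'" for f :: "nat \<Rightarrow> int" and k k'
    using upt_add_eq_append[of 0 k "k' - k"] that by simp
  have "subseq (map f [0..<a]) (map f [0..<a'])" for f :: "nat \<Rightarrow> int"
    unfolding split[OF assms(2)] by (intro subseq_rev_drop_many subseq_order.refl)
  moreover have "subseq (rev (map f [0..<m])) (rev (map f [0..<m']))" for f :: "nat \<Rightarrow> int"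
    unfolding split[OF assms(3)] rev_append by (intro list_emb_append2 subseq_order.refl)
  ultimately show ?thesis unfolding path_word_def using assms(1) by (intro list_emb_append_mono)
qed

lemma path_words_wqo: "wqo_set subseq (path_words N)"
  unfolding wqo_set_def
proof (intro allI impI)
  fix f :: "nat \<Rightarrow> int list" assume "range f \<subseteq> path_words N"
  then have "\<forall>i. \<exists>l u a m. f i = path_word l N u a m \<and> l \<in> {0, 1} \<and> set u \<subseteq> {l..l + int N}"
    unfolding path_words_def by blast
  then obtain l u a m where f: "\<And>i. f i = path_word (l i) N (u i) (a i) (m i)"
    and l: "\<And>i. l i \<in> {0, 1}" and u: "\<And>i. set (u i) \<subseteq> {l i..l i + int N}" by metis
  \<comment> \<open>Negative letters record \<open>l\<close> and count \<open>a\<close> and \<open>m\<close> in unary, which leaves a finite alphabet.\<close>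
  define code where "code i = (- 1 - l i) # u i @ replicate (a i) (- 3) @ replicate (m i) (- 4)" for i
  have u0: "\<forall>x\<in>set (u i). 0 \<le> x \<and> x \<le> int N + 1" for i using l[of i] u[of i] by fastforce
  have "set (code i) \<subseteq> {- 4..int N + 1}" for i
    using l[of i] u0[of i] by (auto simp: code_def)
  then have "range code \<subseteq> lists {- 4..int N + 1}" by fastforce
  with higman[OF wqo_set_eq_finite[of "{- 4..int N + 1}"]]
  obtain i j where ij: "i < j" "subseq (code i) (code j)" unfolding wqo_set_def by blast
  \<comment> \<open>Filtering preserves subwords, and the four parameters use disjoint sets of
    letters, so each can be compared separately.\<close>
  have filt: "subseq (filter P (code i)) (filter P (code j))" for P
    using ij(2) by (rule subseq_filter)
  have none: "filter (\<lambda>x. x = c) (u k) = []" if "c < 0" for k c using u0[of k] that by (auto simp: filter_empty_conv)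
  have "filter (\<lambda>x. 0 \<le> x) (code k) = u k" for k using l[of k] u0[of k] by (auto simp: code_def)
  then have 1: "subseq (u i) (u j)" using filt by metis
  have "filter (\<lambda>x. x = - 3) (code k) = replicate (a k) (- 3)" for k using l[of k] none[of "- 3" k] by (auto simp: code_def)
  then have 2: "a i \<le> a j" using list_emb_length[OF filt, of "\<lambda>x. x = - 3"] by simp
  have "filter (\<lambda>x. x = - 4) (code k) = replicate (m k) (- 4)" for k using l[of k] none[of "- 4" k] by (auto simp: code_def)
  then have 3: "m i \<le> m j" using list_emb_length[OF filt, of "\<lambda>x. x = - 4"] by simp
  have "filter (\<lambda>x. x = - 1 \<or> x = - 2) (code k) = [- 1 - l k]" for k
    using l[of k] u0[of k] by (auto simp: code_def filter_empty_conv)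
  then have 4: "l i = l j" using filt[of "\<lambda>x. x = - 1 \<or> x = - 2"] by (simp split: if_splits)
  show "\<exists>i j. i < j \<and> subseq (f i) (f j)" using ij(1) path_word_subseq[OF 1 2 3] f 4 by metis
qed

definition path_like :: "nat \<Rightarrow> (nat \<times> nat) set set" where
  "path_like N = {S. \<exists>w\<in>path_words N. encodes w S}"

lemma path_like_wqo: "wqo_set embeds (path_like N)"
  unfolding wqo_set_def
proof (intro allI impI)
  fix f :: "nat \<Rightarrow> (nat \<times> nat) set" assume "range f \<subseteq> path_like N"
  then have "\<forall>i. \<exists>w. w \<in> path_words N \<and> encodes w (f i)" unfolding path_like_def by blast
  then obtain w where w: "\<And>i. w i \<in> path_words N" "\<And>i. encodes (w i) (f i)" by metis
  then have "range w \<subseteq> path_words N" by blast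
  then obtain i j where "i < j" "subseq (w i) (w j)" using path_words_wqo unfolding wqo_set_def by blast
  then show "\<exists>i j. i < j \<and> embeds (f i) (f j)" using encodes_subseq_embeds w(2) by blast
qed

lemma path_like_sums_wqo:
  assumes "\<And>\<pi>. \<pi> \<in> C \<Longrightarrow> \<exists>As. set As \<subseteq> path_like N \<and> sum_of As (points \<pi>)"
  shows "wqo_set (\<preceq>) C"
  unfolding wqo_set_def
proof (intro allI impI)
  fix f :: "nat \<Rightarrow> nat list" assume "range f \<subseteq> C"
  then have "\<forall>i. \<exists>As. set As \<subseteq> path_like N \<and> sum_of As (points (f i))" using assms by blast
  then obtain As where As: "\<And>i. set (As i) \<subseteq> path_like N" "\<And>i. sum_of (As i) (points (f i))" by metis
  then have "range As \<subseteq> lists (path_like N)" by blast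
  then obtain i j where "i < j" "list_emb embeds (As i) (As j)"
    using higman[OF path_like_wqo] unfolding wqo_set_def by blast
  then show "\<exists>i j. i < j \<and> f i \<preceq> f j"
    using sum_of_embeds As(2) order_emb_points_imp_contained unfolding embeds_def by blast
qed

lemma wqo_set_imp_well_quasi_ordered:
  assumes "wqo_set (\<preceq>) C"
  shows "well_quasi_ordered C"
  unfolding well_quasi_ordered_def
proof
  assume "\<exists>A\<subseteq>C. infinite A \<and> antichain A"
  then obtain A where A: "A \<subseteq> C" "infinite A" "antichain A" by blast
  then obtain f :: "nat \<Rightarrow> nat list" where f: "inj f" "range f \<subseteq> A" using infinite_countable_subset by blast
  then have "range f \<subseteq> C" using A(1) by blast
  then obtain i j where "i < j" "f i \<preceq> f j" using assms[unfolded wqo_set_def, rule_format] by blast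
  then show False using A(3) f unfolding antichain_def by (metis injD less_irrefl range_subsetD)
qed

section \<open>Connected point sets on the staircase\<close>

definition key :: "nat \<Rightarrow> nat \<times> nat \<Rightarrow> nat" where
  "key c p = (if even c then snd p else fst p)"

text \<open>
  Consecutive cells \<open>c\<close> and \<open>c + 1\<close> share a row if \<open>c\<close> is even and a column if \<open>c\<close> is odd, so
  \<open>key c\<close> is the coordinate in which their points interact. The points \<open>top c\<close> form an induced
  path in the inversion graph.
\<close>

locale staircase =
  fixes A :: "(nat \<times> nat) set" and cell :: "nat \<times> nat \<Rightarrow> nat" and top :: "nat \<Rightarrow> nat \<times> nat"
  assumes gen: "generic A"
    and col_mono: "p \<in> A \<Longrightarrow> q \<in> A \<Longrightarrow> (cell p + 1) div 2 < (cell q + 1) div 2 \<Longrightarrow> fst p < fst q"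
    and row_mono: "p \<in> A \<Longrightarrow> q \<in> A \<Longrightarrow> cell p div 2 < cell q div 2 \<Longrightarrow> snd p < snd q"
    and incr: "p \<in> A \<Longrightarrow> q \<in> A \<Longrightarrow> cell p = cell q \<Longrightarrow> fst p < fst q \<Longrightarrow> snd p < snd q"
    and cell_zero: "p \<in> A \<Longrightarrow> q \<in> A \<Longrightarrow> cell p = 0 \<Longrightarrow> cell q = 0 \<Longrightarrow> p = q"
    and top_in: "p \<in> A \<Longrightarrow> c \<le> cell p \<Longrightarrow> top c \<in> A \<and> cell (top c) = c"
    and top_above: "p \<in> A \<Longrightarrow> cell p = Suc c \<Longrightarrow> key c p < key c (top c)"
    and top_max: "p \<in> A \<Longrightarrow> fst p \<le> fst (top (cell p))"
begin

lemma fst_eq: "p \<in> A \<Longrightarrow> q \<in> A \<Longrightarrow> fst p = fst q \<Longrightarrow> p = q"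
  using gen unfolding generic_def inj_on_def by blast

lemma snd_eq: "p \<in> A \<Longrightarrow> q \<in> A \<Longrightarrow> snd p = snd q \<Longrightarrow> p = q"
  using gen unfolding generic_def inj_on_def by blast

lemma incr_iff:
  assumes "p \<in> A" "q \<in> A" "cell p = cell q"
  shows "fst p < fst q \<longleftrightarrow> snd p < snd q"
  using incr[of p q] incr[of q p] fst_eq[of p q] assms by (metis less_asym linorder_neqE_nat)

lemma key_iff:
  assumes "p \<in> A" "q \<in> A" "cell p = cell q"
  shows "key d p < key d q \<longleftrightarrow> fst p < fst q"
  using incr_iff[OF assms] by (simp add: key_def)

lemma key_eq: "p \<in> A \<Longrightarrow> q \<in> A \<Longrightarrow> key d p = key d q \<Longrightarrow> p = q"
  using fst_eq snd_eq by (auto simp: key_def split: if_splits)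

lemma inversion_same_cell:
  assumes "p \<in> A" "q \<in> A" "cell p = cell q"
  shows "\<not> inversion p q"
  using incr_iff[OF assms] incr_iff[OF assms(2,1)] assms unfolding inversion_def by auto

lemma inversion_far:
  assumes "p \<in> A" "q \<in> A" "cell p + 2 \<le> cell q"
  shows "\<not> inversion p q" "\<not> inversion q p"
proof -
  have "(cell p + 1) div 2 < (cell q + 1) div 2" "cell p div 2 < cell q div 2" using assms(3) by linarith+
  then have "fst p < fst q" "snd p < snd q" using col_mono row_mono assms by blast+
  then show "\<not> inversion p q" "\<not> inversion q p" by (auto simp: inversion_def)
qed

text \<open>Consecutive cells are strictly ordered in the coordinate they do not share, so the
  shared one decides.\<close>

lemma inversion_next:
  assumes "p \<in> A" "q \<in> A" "cell q = Suc (cell p)"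
  shows "inversion p q \<longleftrightarrow> key (cell p) q < key (cell p) p"
proof (cases "even (cell p)")
  case True
  then have "(cell p + 1) div 2 < (cell q + 1) div 2" using assms(3) by (auto elim!: evenE)
  then have "fst p < fst q" using col_mono assms by blast
  then show ?thesis using True by (auto simp: inversion_def key_def)
next
  case False
  then have "cell p div 2 < cell q div 2" using assms(3) by (auto elim!: oddE)
  then have "snd p < snd q" using row_mono assms by blast
  then show ?thesis using False by (auto simp: inversion_def key_def)
qed

lemma inversion_top:
  assumes "p \<in> A" "cell p = Suc c"
  shows "inversion (top c) p"
  using top_in[of p c] inversion_next[of "top c" p] top_above assms by simp

text \<open>By \<open>top_in\<close> the occupied cells form an initial segment, so this says that
  cell \<open>c\<close> is nonempty.\<close>

definition valid :: "nat \<Rightarrow> bool" where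
  "valid c \<longleftrightarrow> (\<exists>p\<in>A. c \<le> cell p)"

lemma valid_top: "valid c \<Longrightarrow> top c \<in> A" "valid c \<Longrightarrow> cell (top c) = c"
  using top_in unfolding valid_def by blast+

lemma valid_mono: "valid d \<Longrightarrow> c \<le> d \<Longrightarrow> valid c"
  unfolding valid_def using le_trans by blast

lemma inversion_tops:
  assumes "valid c" "valid d"
  shows "inversion (top c) (top d) \<longleftrightarrow> d = Suc c \<or> c = Suc d"
proof -
  note t = valid_top[OF assms(1)] valid_top[OF assms(2)]
  consider "d = Suc c" | "c = Suc d" | "c = d" | "c + 2 \<le> d" | "d + 2 \<le> c" by linarith
  then show ?thesis
  proof cases
    case 1 then show ?thesis using inversion_top[of "top d" c] t by simp
  next
    case 2 then show ?thesis using inversion_top[of "top c" d] t inversion_sym by auto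
  next
    case 3 then show ?thesis using inversion_same_cell t by simp
  next
    case 4 then show ?thesis using inversion_far[of "top c" "top d"] t by simp
  next
    case 5 then show ?thesis using inversion_far[of "top d" "top c"] t by simp
  qed
qed

section \<open>Double-ended forks from layers with two points\<close>

text \<open>Two leaves for the path \<open>top s\<close>, \<open>top (Suc s)\<close>, and so on. The
  bound on their cells keeps them away from the leaves at a distant right end.\<close>

definition left_fork :: "nat \<Rightarrow> bool" where
  "left_fork s \<longleftrightarrow> (\<exists>a\<in>A. \<exists>b\<in>A. a \<noteq> b \<and> cell a \<le> Suc s \<and> cell b \<le> Suc s \<and> \<not> inversion a b \<and>
     inversion a (top s) \<and> inversion b (top s) \<and>
     (\<forall>k>s. valid k \<longrightarrow> \<not> inversion a (top k) \<and> \<not> inversion b (top k)))"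

text \<open>Any two points of cell \<open>Suc e\<close> form a right end: both are adjacent to
  \<open>top e\<close>, to no earlier path vertex, and not to each other. The path from
  \<open>top s\<close> to \<open>top e\<close> has \<open>e - s + 1\<close> vertices, and the gap
  \<open>s + 2 \<le> e\<close> separates the leaves of the two ends.\<close>

lemma left_fork_imp_has_fork:
  assumes "left_fork s" and xy: "x \<in> A" "y \<in> A" "x \<noteq> y" "cell x = Suc e" "cell y = Suc e" and se: "s + 2 \<le> e"
  shows "has_fork A (e - s + 1)"
proof -
  obtain a b where ab: "a \<in> A" "b \<in> A" "a \<noteq> b" "cell a \<le> Suc s" "cell b \<le> Suc s" "\<not> inversion a b"
    "inversion a (top s)" "inversion b (top s)"
    and abk: "\<And>k. k > s \<Longrightarrow> valid k \<Longrightarrow> \<not> inversion a (top k)" "\<And>k. k > s \<Longrightarrow> valid k \<Longrightarrow> \<not> inversion b (top k)"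
    using assms(1) unfolding left_fork_def by blast
  define n where "n = e - s + 1"
  have n: "n \<ge> 3" "s + n = Suc e" using se by (simp_all add: n_def)
  have val: "valid k" if "k \<le> e" for k using xy that unfolding valid_def by (intro bexI[of _ x]) auto
  define v where "v i = (if i < n then top (s + i) else if i = n then a else if i = n + 1 then b
    else if i = n + 2 then x else y)" for i
  have vt: "v i = top (s + i)" "valid (s + i)" "v i \<in> A" "cell (v i) = s + i" if "i < n" for i
    using that n val[of "s + i"] valid_top[of "s + i"] by (auto simp: v_def)
  have vl: "v n = a" "v (n + 1) = b" "v (n + 2) = x" "v (n + 3) = y" by (auto simp: v_def)
  have idx: "i < n \<or> i = n \<or> i = n + 1 \<or> i = n + 2 \<or> i = n + 3" if "i < n + 4" for i using that by linarith
  have vA: "v i \<in> A" if "i < n + 4" for i using idx[OF that] vt(3) vl ab xy by auto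
  define fe where "fe i j \<longleftrightarrow> (i < n \<and> j < n \<and> j = Suc i) \<or> (i = 0 \<and> (j = n \<or> j = n + 1)) \<or>
      (i = n - 1 \<and> (j = n + 2 \<or> j = n + 3))" for i j
  have fe: "fork_edge n i j \<longleftrightarrow> fe i j \<or> fe j i" for i j
  proof -
    have "2 \<le> n" using n by simp
    from fork_edge_iff[OF this] show ?thesis unfolding fe_def by blast
  qed
  have leaf: "inversion u (v i) \<longleftrightarrow> i = 0"
    if "i < n" "u \<in> A" "inversion u (top s)" "\<And>k. k > s \<Longrightarrow> valid k \<Longrightarrow> \<not> inversion u (top k)" for i u
    using that vt(1,2)[OF that(1)] by (cases "i = 0") auto
  have leaf': "inversion u (v i) \<longleftrightarrow> i = n - 1" if "i < n" "u \<in> A" "cell u = Suc e" for i u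
  proof (cases "i = n - 1")
    case True
    then have "v i = top e" using vt(1)[OF that(1)] n by simp
    then show ?thesis using True inversion_top[OF that(2,3)] inversion_sym by simp
  next
    case False
    then have "cell (v i) + 2 \<le> cell u" using vt(4)[OF that(1)] that n by linarith
    then show ?thesis using inversion_far[of "v i" u] vt(3) that False by simp
  qed
  have far: "\<not> inversion a x" "\<not> inversion a y" "\<not> inversion b x" "\<not> inversion b y"
    using inversion_far ab xy se by simp_all
  have adj: "inversion (v i) (v j) \<longleftrightarrow> fe i j" if "i \<le> j" "j < n + 4" for i j
  proof (cases "j < n")
    case True
    then show ?thesis
      using that inversion_tops[of "s + i" "s + j"] vt(1,2)[of i] vt(1,2)[of j] n by (auto simp: fe_def)
  next
    case j: False
    show ?thesis
    proof (cases "i < n")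
      case True
      from j idx[OF that(2)] consider "j = n" | "j = n + 1" | "j = n + 2" | "j = n + 3" by blast
      then show ?thesis
      proof cases
        case 1 then show ?thesis using leaf[OF True ab(1,7) abk(1)] inversion_sym vl n True by (auto simp: fe_def)
      next
        case 2 then show ?thesis using leaf[OF True ab(2,8) abk(2)] inversion_sym vl n True by (auto simp: fe_def)
      next
        case 3 then show ?thesis using leaf'[OF True xy(1,4)] inversion_sym vl n True by (auto simp: fe_def)
      next
        case 4 then show ?thesis using leaf'[OF True xy(2,5)] inversion_sym vl n True by (auto simp: fe_def)
      qed
    next
      case False
      then have "\<not> fe i j" using j n by (auto simp: fe_def)
      moreover have "\<not> inversion (v i) (v i)" by (simp add: inversion_def)
      moreover have "\<not> inversion x y" using inversion_same_cell xy by simp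
      ultimately show ?thesis using idx[of i] idx[of j] that False j vl far ab(6) by auto
    qed
  qed
  \<comment> \<open>The cell bound leaves only \<open>top s\<close>, which is not adjacent to
    itself, and \<open>top (Suc s)\<close>, which is adjacent to the later vertex
    \<open>top (Suc (Suc s))\<close>.\<close>
  have not_top: "u \<noteq> v i"
    if "i < n" "u \<in> A" "cell u \<le> Suc s" "inversion u (top s)" "\<And>k. k > s \<Longrightarrow> valid k \<Longrightarrow> \<not> inversion u (top k)"
    for i u
  proof
    assume u: "u = v i"
    then have "s + i \<le> Suc s" using vt(4)[OF that(1)] that(3) by simp
    then have "i \<le> 1" by simp
    have valid: "valid s" "valid (Suc s)" "valid (Suc (Suc s))" using se val by auto
    have "i = 1" using \<open>i \<le> 1\<close> inversion_tops[OF valid(1,1)] that(4) u vt(1)[OF that(1)] by (cases "i = 0") auto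
    then have "inversion u (top (Suc (Suc s)))"
      using inversion_tops[OF valid(2,3)] u vt(1)[OF that(1)] by simp
    then show False using that(5)[OF _ valid(3)] by simp
  qed
  have dist: "v i \<noteq> v j" if "i < j" "j < n + 4" for i j
  proof (cases "j < n")
    case True
    then show ?thesis using vt(4)[of i] vt(4)[of j] that by auto
  next
    case j: False
    have diff: "a \<noteq> x" "a \<noteq> y" "b \<noteq> x" "b \<noteq> y" using ab xy se by auto
    show ?thesis
    proof (cases "i < n")
      case True
      have "cell (v i) \<noteq> Suc e" using vt(4)[OF True] True n by simp
      then have "v i \<noteq> x" "v i \<noteq> y" using xy by auto
      moreover have "v i \<noteq> a" "v i \<noteq> b"
        using not_top[OF True ab(1,4,7) abk(1)] not_top[OF True ab(2,5,8) abk(2)] by auto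
      ultimately show ?thesis using idx[OF that(2)] j vl by auto
    next
      case False
      then show ?thesis using idx[of i] idx[of j] that j vl diff ab(3) xy(3) by auto
    qed
  qed
  have "inj_on v {..<n + 4}"
  proof (rule inj_onI)
    fix i j assume "i \<in> {..<n + 4}" "j \<in> {..<n + 4}" "v i = v j"
    then show "i = j" using dist[of i j] dist[of j i] by (metis lessThan_iff linorder_neqE_nat)
  qed
  moreover have "inversion (v i) (v j) \<longleftrightarrow> fork_edge n i j" if "i < n + 4" "j < n + 4" for i j
  proof -
    have fe_lt: "\<not> fe j i" if "i \<le> j" for i j using that n by (auto simp: fe_def)
    show ?thesis
    proof (cases "i \<le> j")
      case True then show ?thesis using adj[OF True that(2)] fe fe_lt by blast
    next
      case False then show ?thesis using adj[of j i] that fe fe_lt[of j i] inversion_sym[of "v i"] by auto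
    qed
  qed
  ultimately show ?thesis unfolding has_fork_def n_def[symmetric] using vA by (intro exI[of _ v]) auto
qed

definition thick :: "nat \<Rightarrow> bool" where
  "thick c \<longleftrightarrow> (\<exists>x\<in>A. cell x = c \<and> x \<noteq> top c)"

lemma thick_valid: "thick c \<Longrightarrow> valid c"
  unfolding thick_def valid_def by blast

lemma inversion_imp_adjacent_cells:
  assumes "p \<in> A" "q \<in> A" "inversion p q"
  shows "cell q = Suc (cell p) \<or> cell p = Suc (cell q)"
  using assms inversion_same_cell[of p q] inversion_far[of p q] inversion_far[of q p] by (metis add_2_eq_Suc' not_less_eq_eq le_antisym Suc_leI linorder_neqE_nat)

text \<open>The leaves are \<open>x\<close> and \<open>top (cell x)\<close>: they share a cell, and
  the next path vertex is adjacent to both.\<close>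

lemma left_fork_after:
  assumes "x \<in> A" "x \<noteq> top (cell x)" "valid (Suc (cell x))" "inversion x (top (Suc (cell x)))"
  shows "left_fork (Suc (cell x))"
proof -
  let ?j = "cell x"
  have val: "valid ?j" using assms(3) valid_mono by simp
  note t = valid_top[OF val] valid_top[OF assms(3)]
  have "\<not> inversion x (top k) \<and> \<not> inversion (top ?j) (top k)" if "k > Suc ?j" "valid k" for k
    using inversion_far[of x "top k"] inversion_tops[OF val that(2)] assms(1) valid_top[OF that(2)] that by auto
  then show ?thesis
    unfolding left_fork_def using assms t inversion_tops[OF val assms(3)] inversion_same_cell[of x "top ?j"]
    by (intro bexI[of _ x] bexI[of _ "top ?j"]) auto
qed

text \<open>Here \<open>x\<close> is a dead end behind \<open>top (Suc i)\<close>, so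
  \<open>x\<close> and \<open>top i\<close> are the leaves there, while the path continues through
  \<open>top (Suc (Suc i))\<close>.\<close>

lemma left_fork_before:
  assumes "x \<in> A" "x \<noteq> top (cell x)" "cell x = Suc (Suc i)" "valid (Suc (cell x)) \<Longrightarrow> \<not> inversion x (top (Suc (cell x)))"
  shows "left_fork (Suc i)"
proof -
  have val: "valid i" "valid (Suc i)" "valid (Suc (Suc i))" using assms unfolding valid_def by (auto intro!: bexI[of _ x])
  note t = valid_top[OF val(1)] valid_top[OF val(2)] valid_top[OF val(3)]
  have "\<not> inversion x (top k) \<and> \<not> inversion (top i) (top k)" if "k > Suc i" "valid k" for k
    using inversion_imp_adjacent_cells[of x "top k"] inversion_tops[OF val(1) that(2)] assms valid_top[OF that(2)] that by auto
  moreover have "inversion x (top (Suc i))" using inversion_top assms(1,3) inversion_sym by blast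
  moreover have "\<not> inversion x (top i)" using inversion_far[of "top i" x] t assms by simp
  moreover have "x \<noteq> top i" using assms(3) t by auto
  ultimately show ?thesis
    unfolding left_fork_def using assms t inversion_tops[OF val(1,2)]
    by (intro bexI[of _ x] bexI[of _ "top i"]) auto
qed

text \<open>No path vertex precedes \<open>top 0\<close>, so both leaves must come from cell
  1.\<close>

lemma left_fork_zero:
  assumes "x \<in> A" "y \<in> A" "x \<noteq> y" "cell x = 1" "cell y = 1"
    and "valid 2 \<Longrightarrow> \<not> inversion x (top 2)" "valid 2 \<Longrightarrow> \<not> inversion y (top 2)"
  shows "left_fork 0"
proof -
  have "\<not> inversion u (top k)" if "k > 0" "valid k" "u \<in> A" "cell u = 1" "valid 2 \<Longrightarrow> \<not> inversion u (top 2)" for k u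
    using inversion_imp_adjacent_cells[of u "top k"] valid_top[OF that(2)] that by (auto simp: numeral_2_eq_2)
  moreover have "inversion x (top 0)" "inversion y (top 0)" using inversion_top assms inversion_sym by auto
  ultimately show ?thesis
    unfolding left_fork_def using assms inversion_same_cell[of x y]
    by (intro bexI[of _ x] bexI[of _ y]) auto
qed

text \<open>Whether or not the extra point of layer \<open>j\<close> is adjacent to
  \<open>top (Suc j)\<close>, it gives a left end at some \<open>s \<le> Suc j\<close>. With
  \<open>e = i - 1\<close> the layer \<open>i\<close> supplies the right end, and the path has
  \<open>i - s\<close> vertices, at least \<open>K\<close> if \<open>i > j + K\<close>.\<close>

lemma thick_window:
  assumes nofork: "\<And>n. n \<ge> K \<Longrightarrow> \<not> has_fork A n" and K: "K \<ge> 3"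
    and "thick j" "j \<ge> 2" "thick i"
  shows "i \<le> j + K"
proof (rule ccontr)
  assume "\<not> i \<le> j + K"
  then have ij: "j + K + 1 \<le> i" by simp
  obtain x where x: "x \<in> A" "cell x = j" "x \<noteq> top j" using assms unfolding thick_def by blast
  obtain y where y: "y \<in> A" "cell y = i" "y \<noteq> top i" using assms unfolding thick_def by blast
  have val: "valid i" "valid (Suc j)" using y ij unfolding valid_def by (auto intro!: bexI[of _ y])
  obtain s where s: "left_fork s" "s \<le> Suc j"
  proof (cases "inversion x (top (Suc j))")
    case True
    then show thesis using left_fork_after[of x] x val that by auto
  next
    case False
    obtain k where "j = Suc (Suc k)" using \<open>j \<ge> 2\<close> by (metis add_2_eq_Suc le_Suc_ex)
    then show thesis using left_fork_before[of x k] x False that by auto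
  qed
  have "has_fork A (i - 1 - s + 1)"
    using y valid_top[OF val(1)] s(2) ij K by (intro left_fork_imp_has_fork[OF s(1), of y "top i"]) auto
  moreover have "K \<le> i - 1 - s + 1" using s(2) ij by linarith
  ultimately show False using nofork by blast
qed

section \<open>Listing the points in word order\<close>

text \<open>The condition that \<open>encodes_intro\<close> puts on reading \<open>p\<close> ahead
  of \<open>q\<close>. It holds both ways between cells at distance at least two, so it is not an
  order, and the existence of a compatible listing needs an argument.\<close>

definition before :: "nat \<times> nat \<Rightarrow> nat \<times> nat \<Rightarrow> bool" where
  "before p q \<longleftrightarrow> ((cell p + 1) div 2 = (cell q + 1) div 2 \<longrightarrow> fst p < fst q) \<and>
     (cell p div 2 = cell q div 2 \<longrightarrow> snd p < snd q)"

lemma before_far: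
  assumes "cell p + 2 \<le> cell q \<or> cell q + 2 \<le> cell p"
  shows "before p q"
  unfolding before_def using assms by auto

lemma before_same:
  assumes "p \<in> A" "q \<in> A" "cell p = cell q"
  shows "before p q \<longleftrightarrow> fst p < fst q"
  using incr_iff[OF assms] assms by (simp add: before_def)

lemma before_next:
  assumes "cell q = Suc (cell p)"
  shows "before p q \<longleftrightarrow> key (cell p) p < key (cell p) q" "before q p \<longleftrightarrow> key (cell p) q < key (cell p) p"
  using assms by (cases "even (cell p)"; auto simp: before_def key_def elim!: evenE oddE)+

lemma before_top:
  assumes "p \<in> A" "c < cell p"
  shows "before p (top c)"
proof -
  have c: "cell (top c) = c" using top_in[of p c] assms by simp
  show ?thesis
  proof (cases "cell p = Suc c")
    case True
    then show ?thesis using before_next(2)[of p "top c"] top_above[OF assms(1) True] c by simp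
  qed (use before_far[of p "top c"] assms c in simp)
qed

text \<open>Only consecutive cells can conflict. Call an occupied cell good if its least point may
  precede all points of the previous cell; the lowest occupied cell is good. In the last good cell
  \<open>c\<close> the least point works: a conflict with a point of cell \<open>c + 1\<close> would
  put the least point of that cell below all of cell \<open>c\<close>, making \<open>c + 1\<close>
  good.\<close>

lemma exists_minimal:
  assumes "S \<subseteq> A" "S \<noteq> {}"
  shows "\<exists>m\<in>S. \<forall>q\<in>S. q \<noteq> m \<longrightarrow> before m q"
proof -
  have finS: "finite S" using assms(1) gen finite_subset unfolding generic_def by blast
  have "\<exists>m. m \<in> S \<and> cell m = c \<and> (\<forall>q\<in>S. cell q = c \<longrightarrow> fst m \<le> fst q)" if "c \<in> cell ` S" for c
  proof -
    define T where "T = fst ` {p \<in> S. cell p = c}"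
    have T: "T \<noteq> {}" "finite T" using that finS by (auto simp: T_def)
    obtain m where "m \<in> S" "cell m = c" "fst m = Min T" using Min_in[OF T(2,1)] by (auto simp: T_def)
    moreover have "Min T \<le> fst q" if "q \<in> S" "cell q = c" for q using T(2) that by (auto simp: T_def intro!: Min_le)
    ultimately show ?thesis by (intro exI[of _ m]) auto
  qed
  then obtain mn where mn: "\<And>c. c \<in> cell ` S \<Longrightarrow> mn c \<in> S" "\<And>c. c \<in> cell ` S \<Longrightarrow> cell (mn c) = c"
    "\<And>c q. c \<in> cell ` S \<Longrightarrow> q \<in> S \<Longrightarrow> cell q = c \<Longrightarrow> fst (mn c) \<le> fst q" by metis
  have key_mn: "key d (mn c) \<le> key d q" if "q \<in> S" "cell q = c" for c d q
  proof -
    have c: "c \<in> cell ` S" using that by blast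
    have "mn c \<in> A" "q \<in> A" using mn(1)[OF c] that assms(1) by auto
    moreover have "cell (mn c) = cell q" "fst (mn c) \<le> fst q" using mn(2,3)[OF c] that by auto
    ultimately show ?thesis using key_iff[of q "mn c" d] by simp
  qed
  define G where "G = {c \<in> cell ` S. \<forall>q\<in>S. Suc (cell q) = c \<longrightarrow> before (mn c) q}"
  have finG: "finite G" using finS by (simp add: G_def)
  have "Min (cell ` S) \<in> G"
  proof -
    have "Min (cell ` S) \<le> cell q" if "q \<in> S" for q using finS that by simp
    then have "Suc (cell q) \<noteq> Min (cell ` S)" if "q \<in> S" for q using that by fastforce
    then show ?thesis using Min_in[of "cell ` S"] finS assms(2) by (auto simp: G_def)
  qed
  define c where "c = Max G"
  have cG: "c \<in> G" using \<open>Min (cell ` S) \<in> G\<close> finG Max_in c_def by blast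
  have c: "c \<in> cell ` S" using cG by (simp add: G_def)
  define m where "m = mn c"
  have m: "m \<in> S" "cell m = c" using mn[OF c] by (simp_all add: m_def)
  have "before m q" if q: "q \<in> S" "q \<noteq> m" for q
  proof -
    have qA: "q \<in> A" "m \<in> A" using q m assms(1) by auto
    consider "cell q = c" | "Suc (cell q) = c" | "cell q = Suc c" | "cell q + 2 \<le> c \<or> c + 2 \<le> cell q"
      by linarith
    then show ?thesis
    proof cases
      case 1
      then have "fst m < fst q" using mn(3)[OF c q(1)] fst_eq[OF qA] q(2) by (fastforce simp: m_def)
      then show ?thesis using before_same qA m 1 by simp
    next
      case 2
      then show ?thesis using cG q by (simp add: G_def m_def)
    next
      case 3
      show ?thesis
      proof (rule ccontr)
        assume "\<not> before m q"
        then have less: "key c q < key c m"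
          using before_next(1)[of q m] 3 m(2) key_eq[OF qA, of c] q(2) by (metis linorder_neqE_nat)
        have c': "Suc c \<in> cell ` S" using q(1) 3 by force
        have "before (mn (Suc c)) r" if r: "r \<in> S" "Suc (cell r) = Suc c" for r
        proof -
          have "key c (mn (Suc c)) < key c r"
            using key_mn[OF q(1) 3, of c] less key_mn[OF r(1), of c c] r(2) by (simp add: m_def)
          then show ?thesis using before_next(2)[of "mn (Suc c)" r] mn(2)[OF c'] r by simp
        qed
        then have "Suc c \<in> G" using c' by (simp add: G_def)
        then have "Suc c \<le> c" using finG by (simp add: c_def)
        then show False by simp
      qed
    next
      case 4
      then show ?thesis using before_far[of m q] m(2) by auto
    qed
  qed
  then show ?thesis using m(1) by blast
qed

lemma linear_extension:
  assumes "S \<subseteq> A"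
  shows "\<exists>ps. set ps = S \<and> distinct ps \<and> sorted_wrt before ps"
proof -
  have "finite S" using assms gen finite_subset unfolding generic_def by blast
  then show ?thesis using assms
  proof (induction S rule: finite_psubset_induct)
    case (psubset S)
    show ?case
    proof (cases "S = {}")
      case False
      then obtain m where m: "m \<in> S" "\<forall>q\<in>S. q \<noteq> m \<longrightarrow> before m q" using exists_minimal psubset.prems by blast
      then have "S - {m} \<subset> S" "S - {m} \<subseteq> A" using psubset.prems by auto
      then obtain ps where "set ps = S - {m}" "distinct ps" "sorted_wrt before ps" using psubset.IH by blast
      then show ?thesis using m by (intro exI[of _ "m # ps"]) auto
    qed auto
  qed
qed

text \<open>
  Outside the cells \<open>l, \<dots>, l + N\<close> the points can be read by decreasing cell, because \<open>top c\<close> exceeds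
  all of cell \<open>c + 1\<close>. Only the cells of the window need a topological sort.
\<close>

lemma path_word_order:
  assumes single: "\<And>p. p \<in> A \<Longrightarrow> cell p < l \<or> l + N \<le> cell p \<Longrightarrow> p = top (cell p)" and "valid l"
  shows "\<exists>ps u m. set ps = A \<and> distinct ps \<and> sorted_wrt before ps \<and> set u \<subseteq> {int l..int l + int N} \<and>
    map (\<lambda>p. int (cell p)) ps = path_word (int l) N u l m"
proof -
  define M where "M = Max (cell ` A)"
  have finA: "finite A" using gen by (simp add: generic_def)
  have le_M: "cell p \<le> M" if "p \<in> A" for p using that finA by (simp add: M_def)
  have "A \<noteq> {}" using \<open>valid l\<close> by (auto simp: valid_def)
  then have "M \<in> cell ` A" using finA by (simp add: M_def)
  then have val: "valid c" if "c \<le> M" for c using that by (auto simp: valid_def)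
  have "l \<le> M" using \<open>valid l\<close> le_M le_trans unfolding valid_def by blast
  \<comment> \<open>Truncated subtraction makes the upper run empty when the window reaches beyond
    the last cell.\<close>
  define m where "m = M - (l + N)"
  define core where "core = {p \<in> A. l \<le> cell p \<and> cell p \<le> l + N}"
  obtain cs where cs: "set cs = core" "distinct cs" "sorted_wrt before cs"
    using linear_extension[of core] by (auto simp: core_def)
  define hs where "hs = map (\<lambda>i. top (l + N + 1 + i)) (rev [0..<m])"
  define ls where "ls = map (\<lambda>i. top (l - 1 - i)) [0..<l]"
  have h: "top (l + N + 1 + i) \<in> A" "cell (top (l + N + 1 + i)) = l + N + 1 + i" if "i < m" for i
    using valid_top[OF val[of "l + N + 1 + i"]] that by (simp_all add: m_def)
  have t: "top (l - 1 - i) \<in> A" "cell (top (l - 1 - i)) = l - 1 - i" if "i < l" for i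
    using valid_top[OF val[of "l - 1 - i"]] \<open>l \<le> M\<close> that by simp_all
  have set_hs: "set hs = {p \<in> A. l + N < cell p}"
  proof (intro equalityI subsetI)
    fix p assume "p \<in> set hs"
    then obtain i where "i < m" "p = top (l + N + 1 + i)" by (auto simp: hs_def)
    then show "p \<in> {p \<in> A. l + N < cell p}" using h[of i] by simp
  next
    fix p assume "p \<in> {p \<in> A. l + N < cell p}"
    then have p: "p \<in> A" "l + N < cell p" "p = top (cell p)" using single[of p] by auto
    then have "cell p - (l + N + 1) < m" "l + N + 1 + (cell p - (l + N + 1)) = cell p"
      using le_M[OF p(1)] by (auto simp: m_def)
    then have "p = top (l + N + 1 + (cell p - (l + N + 1)))" "cell p - (l + N + 1) \<in> set (rev [0..<m])"
      using p(3) by auto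
    then show "p \<in> set hs" unfolding hs_def set_map by (rule image_eqI)
  qed
  have set_ls: "set ls = {p \<in> A. cell p < l}"
  proof (intro equalityI subsetI)
    fix p assume "p \<in> set ls"
    then obtain i where i: "i < l" "p = top (l - 1 - i)" by (auto simp: ls_def)
    then show "p \<in> {p \<in> A. cell p < l}" using t[of i] by simp
  next
    fix p assume "p \<in> {p \<in> A. cell p < l}"
    then have p: "p \<in> A" "cell p < l" "p = top (cell p)" using single[of p] by auto
    then have "l - 1 - (l - 1 - cell p) = cell p" by simp
    then have "p = top (l - 1 - (l - 1 - cell p))" "l - 1 - cell p \<in> set [0..<l]" using p by auto
    then show "p \<in> set ls" unfolding ls_def set_map by (rule image_eqI)
  qed
  define ps where "ps = hs @ cs @ ls"
  have "set ps = A" by (auto simp: ps_def set_hs set_ls cs(1) core_def)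
  moreover have "distinct ps"
  proof -
    have "inj_on (\<lambda>i. top (l + N + 1 + i)) {0..<m}"
    proof (rule inj_onI)
      fix i j assume "i \<in> {0..<m}" "j \<in> {0..<m}" "top (l + N + 1 + i) = top (l + N + 1 + j)"
      then show "i = j" using h(2)[of i] h(2)[of j] by simp
    qed
    then have "distinct hs" by (simp add: hs_def distinct_map)
    moreover have "inj_on (\<lambda>i. top (l - 1 - i)) {0..<l}"
    proof (rule inj_onI)
      fix i j assume "i \<in> {0..<l}" "j \<in> {0..<l}" "top (l - 1 - i) = top (l - 1 - j)"
      moreover from this have "l - 1 - i = l - 1 - j" using t(2)[of i] t(2)[of j] by simp
      ultimately show "i = j" by auto
    qed
    then have "distinct ls" by (simp add: ls_def distinct_map)
    ultimately show ?thesis using cs(2) by (auto simp: ps_def set_hs set_ls cs(1) core_def)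
  qed
  moreover have "sorted_wrt before ps"
  proof -
    have top_before: "before p q" if "p \<in> A" "q \<in> A" "q = top (cell q)" "cell q < cell p" for p q
      using before_top[OF that(1,4)] that(3) by simp
    have "sorted_wrt before hs"
      unfolding hs_def sorted_wrt_map sorted_wrt_rev
    proof (rule sorted_wrt_mono_rel[OF _ strict_sorted_iff[THEN iffD2]])
      fix i j assume "i \<in> set [0..<m]" "j \<in> set [0..<m]" "i < j"
      then show "before (top (l + N + 1 + j)) (top (l + N + 1 + i))"
        using h[of i] h[of j] by (intro top_before) auto
    qed auto
    moreover have "sorted_wrt before ls"
      unfolding ls_def sorted_wrt_map
    proof (rule sorted_wrt_mono_rel[OF _ strict_sorted_iff[THEN iffD2]])
      fix i j assume "i \<in> set [0..<l]" "j \<in> set [0..<l]" "i < j"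
      then show "before (top (l - 1 - i)) (top (l - 1 - j))"
        using t[of i] t[of j] by (intro top_before) auto
    qed auto
    \<comment> \<open>The assumption \<open>single\<close> includes cell \<open>l + N\<close>, the
      last one of the window, because a point of the next cell is only guaranteed to precede its
      \<open>top\<close>.\<close>
    moreover have "before p q" if "p \<in> set hs" "q \<in> core" for p q
    proof (cases "cell q = l + N")
      case True
      then show ?thesis using that single[of q] by (intro top_before) (auto simp: set_hs core_def)
    next
      case False
      then show ?thesis using that by (intro before_far) (auto simp: set_hs core_def)
    qed
    moreover have "before p q" if "p \<in> set hs \<union> core" "q \<in> set ls" for p q
      using that single[of q] by (intro top_before) (auto simp: set_hs set_ls core_def)
    ultimately show ?thesis using cs by (auto simp: ps_def sorted_wrt_append)
  qed
  moreover have "map (\<lambda>p. int (cell p)) ps = path_word (int l) N (map (\<lambda>p. int (cell p)) cs) l m"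
  proof -
    have "map (\<lambda>p. int (cell p)) hs = rev (map (\<lambda>i. int l + int N + 1 + int i) [0..<m])"
      using h(2) by (simp add: hs_def rev_map)
    moreover have "map (\<lambda>p. int (cell p)) ls = map (\<lambda>i. int l - 1 - int i) [0..<l]"
      using t(2) by (auto simp: ls_def)
    ultimately show ?thesis by (simp add: ps_def path_word_def)
  qed
  moreover have "set (map (\<lambda>p. int (cell p)) cs) \<subseteq> {int l..int l + int N}" using cs(1) by (auto simp: core_def)
  ultimately show ?thesis by blast
qed

text \<open>All existence requirements of the locale concern the points \<open>top c\<close>, so any
  other point can be split off and treated separately.\<close>

lemma staircase_remove:
  assumes "x \<noteq> top (cell x)"
  shows "staircase (A - {x}) cell top"
proof
  show "generic (A - {x})" using generic_subset gen by blast
  fix p q c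
  show "p \<in> A - {x} \<Longrightarrow> q \<in> A - {x} \<Longrightarrow> (cell p + 1) div 2 < (cell q + 1) div 2 \<Longrightarrow> fst p < fst q"
    using col_mono by blast
  show "p \<in> A - {x} \<Longrightarrow> q \<in> A - {x} \<Longrightarrow> cell p div 2 < cell q div 2 \<Longrightarrow> snd p < snd q"
    using row_mono by blast
  show "p \<in> A - {x} \<Longrightarrow> q \<in> A - {x} \<Longrightarrow> cell p = cell q \<Longrightarrow> fst p < fst q \<Longrightarrow> snd p < snd q"
    using incr by blast
  show "p \<in> A - {x} \<Longrightarrow> q \<in> A - {x} \<Longrightarrow> cell p = 0 \<Longrightarrow> cell q = 0 \<Longrightarrow> p = q" using cell_zero by blast
  show "p \<in> A - {x} \<Longrightarrow> c \<le> cell p \<Longrightarrow> top c \<in> A - {x} \<and> cell (top c) = c" using top_in[of p c] assms by auto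
  show "p \<in> A - {x} \<Longrightarrow> cell p = Suc c \<Longrightarrow> key c p < key c (top c)" using top_above by blast
  show "p \<in> A - {x} \<Longrightarrow> fst p \<le> fst (top (cell p))" using top_max by blast
qed

lemma int_div_2: "(int a + 1) div 2 = int ((a + 1) div 2)" "int a div 2 = int (a div 2)"
  by (simp_all add: zdiv_int)

lemma path_word_encodes:
  assumes "\<And>p. p \<in> A \<Longrightarrow> cell p < l \<or> l + N \<le> cell p \<Longrightarrow> p = top (cell p)" and "valid l"
  shows "\<exists>u a m. set u \<subseteq> {int l..int l + int N} \<and> encodes (path_word (int l) N u a m) A"
proof -
  obtain ps u m where ps: "set ps = A" "distinct ps" "sorted_wrt before ps" "set u \<subseteq> {int l..int l + int N}"
    "map (\<lambda>p. int (cell p)) ps = path_word (int l) N u l m" using path_word_order[OF assms] by blast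
  have "encodes (map (\<lambda>p. int (cell p)) ps) A"
  proof (rule encodes_intro[OF ps(1,2) gen])
    show "sorted_wrt (\<lambda>p q. ((int (cell p) + 1) div 2 = (int (cell q) + 1) div 2 \<longrightarrow> fst p < fst q) \<and>
       (int (cell p) div 2 = int (cell q) div 2 \<longrightarrow> snd p < snd q)) ps"
      using ps(3) unfolding before_def int_div_2 of_nat_eq_iff .
  qed (use col_mono row_mono in \<open>simp_all add: int_div_2\<close>)
  then show ?thesis using ps(4,5) by auto
qed

text \<open>
  A second point in cell 1 that is not adjacent to cell 2 extends the path by one step: it becomes
  the only point of a new cell \<open>- 1\<close>.
\<close>

lemma path_word_encodes_extra:
  assumes x: "x \<in> A" "cell x = 1" "x \<noteq> top 1" "\<not> inversion x (top 2)"
    and single: "\<And>p. p \<in> A \<Longrightarrow> p \<noteq> x \<Longrightarrow> cell p < l \<or> l + N \<le> cell p \<Longrightarrow> p = top (cell p)"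
    and "valid l" "l \<ge> 3"
  shows "\<exists>u a m. set u \<subseteq> {int l..int l + int N} \<and> encodes (path_word (int l) N u a m) A"
proof -
  interpret R: staircase "A - {x}" cell top using staircase_remove[of x] x by simp
  have "R.valid l" using \<open>valid l\<close> \<open>l \<ge> 3\<close> x(2) unfolding valid_def R.valid_def by fastforce
  then obtain ps u m where ps: "set ps = A - {x}" "distinct ps" "sorted_wrt R.before ps"
    "set u \<subseteq> {int l..int l + int N}" "map (\<lambda>p. int (cell p)) ps = path_word (int l) N u l m"
    using R.path_word_order[of l N] single by blast
  \<comment> \<open>Cell \<open>- 1\<close> has column 0 and row \<open>- 1\<close>. This fits
    \<open>x\<close> if it is below every other point and left of all of them except the point of
    cell 0, with which it now shares a column.\<close>
  define cell' where "cell' p = (if p = x then - 1 else int (cell p))" for p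
  have above_x: "snd x < snd p \<and> (cell p \<noteq> 0 \<longrightarrow> fst x < fst p)" if p: "p \<in> A" "p \<noteq> x" for p
  proof -
    consider "cell p = 0" | "cell p = 1" | "cell p = 2" | "cell p \<ge> 3" by linarith
    then show ?thesis
    proof cases
      case 1
      have "p = top 0" using single[OF p] 1 \<open>l \<ge> 3\<close> by simp
      then show ?thesis using top_above[OF x(1), of 0] x(2) 1 by (simp add: key_def)
    next
      case 2
      have "p = top 1" using single[OF p] 2 \<open>l \<ge> 3\<close> by simp
      then have "fst x < fst p" using top_max[OF x(1)] x(2) fst_eq[OF x(1) p(1)] p(2) by fastforce
      then show ?thesis using incr[OF x(1) p(1)] x(2) 2 by simp
    next
      case 3
      have "p = top 2" using single[OF p] 3 \<open>l \<ge> 3\<close> by simp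
      then have "\<not> key 1 p < key 1 x" using inversion_next[OF x(1), of p] x(2,4) 3 p by simp
      then have "fst x < fst p" using fst_eq[OF x(1) p(1)] p(2) by (fastforce simp: key_def)
      moreover have "snd x < snd p" using row_mono[OF x(1) p(1)] x(2) 3 by simp
      ultimately show ?thesis by simp
    next
      case 4
      then have "(cell x + 1) div 2 < (cell p + 1) div 2" "cell x div 2 < cell p div 2" using x(2) by auto
      then show ?thesis using row_mono[OF x(1) p(1)] col_mono[OF x(1) p(1)] by simp
    qed
  qed
  have below_x: "fst p < fst x" if "p \<in> A" "cell p = 0" for p
    using col_mono[OF that(1) x(1)] that x(2) by simp
  have col_x: "(cell' x + 1) div 2 = 0" "cell' x div 2 = - 1" by (simp_all add: cell'_def)
  have col_p: "(cell' p + 1) div 2 = int ((cell p + 1) div 2)" "cell' p div 2 = int (cell p div 2)" if "p \<noteq> x" for p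
    using that by (simp_all add: cell'_def int_div_2)
  have "encodes (map cell' (ps @ [x])) A"
  proof (rule encodes_intro[OF _ _ gen])
    show "set (ps @ [x]) = A" "distinct (ps @ [x])" using ps x by auto
    fix p q assume pq: "p \<in> A" "q \<in> A"
    show "fst p < fst q" if "(cell' p + 1) div 2 < (cell' q + 1) div 2"
    proof (cases "p = x"; cases "q = x")
      assume "p \<noteq> x" "q \<noteq> x"
      then show ?thesis using that col_mono pq by (simp add: col_p)
    next
      assume "p \<noteq> x" "q = x"
      then show ?thesis using that col_x(1) col_p(1)[of p] by simp
    next
      assume "p = x" "q \<noteq> x"
      moreover from this have "cell q \<noteq> 0" using that col_x(1) col_p(1)[of q] by auto
      ultimately show ?thesis using above_x[OF pq(2)] by simp
    qed (use that in simp)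
    show "snd p < snd q" if "cell' p div 2 < cell' q div 2"
    proof (cases "p = x"; cases "q = x")
      assume "p \<noteq> x" "q \<noteq> x"
      then show ?thesis using that row_mono pq by (simp add: col_p)
    next
      assume "p \<noteq> x" "q = x"
      then show ?thesis using that col_x(2) col_p(2)[of p] by simp
    next
      assume "p = x" "q \<noteq> x"
      then show ?thesis using above_x[OF pq(2)] by simp
    qed (use that in simp)
  next
    have "sorted_wrt (\<lambda>p q. ((cell' p + 1) div 2 = (cell' q + 1) div 2 \<longrightarrow> fst p < fst q) \<and>
       (cell' p div 2 = cell' q div 2 \<longrightarrow> snd p < snd q)) ps"
    proof (rule sorted_wrt_mono_rel[OF _ ps(3)])
      fix p q assume "p \<in> set ps" "q \<in> set ps" "R.before p q"
      moreover from this have "p \<noteq> x" "q \<noteq> x" using ps(1) by auto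
      ultimately show "((cell' p + 1) div 2 = (cell' q + 1) div 2 \<longrightarrow> fst p < fst q) \<and>
       (cell' p div 2 = cell' q div 2 \<longrightarrow> snd p < snd q)" by (simp add: R.before_def col_p)
    qed
    moreover have "((cell' p + 1) div 2 = (cell' x + 1) div 2 \<longrightarrow> fst p < fst x) \<and>
       (cell' p div 2 = cell' x div 2 \<longrightarrow> snd p < snd x)" if "p \<in> set ps" for p
    proof -
      have "p \<in> A" "p \<noteq> x" using that ps(1) by auto
      then show ?thesis unfolding col_x col_p[OF \<open>p \<noteq> x\<close>] using below_x[of p] by auto
    qed
    ultimately show "sorted_wrt (\<lambda>p q. ((cell' p + 1) div 2 = (cell' q + 1) div 2 \<longrightarrow> fst p < fst q) \<and>
       (cell' p div 2 = cell' q div 2 \<longrightarrow> snd p < snd q)) (ps @ [x])" by (simp add: sorted_wrt_append)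
  qed
  \<comment> \<open>The lower run of length \<open>l\<close> ends at cell 0, so the final letter
    \<open>- 1\<close> continues it.\<close>
  moreover have "map cell' (ps @ [x]) = path_word (int l) N u (Suc l) m"
  proof -
    have "map cell' ps = map (\<lambda>p. int (cell p)) ps" using ps(1) by (intro map_cong) (auto simp: cell'_def)
    then show ?thesis using ps(5) by (simp add: path_word_def cell'_def)
  qed
  ultimately show ?thesis using ps(4) by auto
qed

text \<open>If all thick layers are below \<open>K + 3\<close>, the window starts at 0. Otherwise
  some thick \<open>i \<ge> K + 3\<close> completes any left end with \<open>s \<le> 2\<close> to a
  long fork, and the window starts at the least thick layer \<open>l \<ge> 2\<close>;
  \<open>thick_window\<close> gives \<open>i \<le> l + K\<close>, hence \<open>l \<ge> 3\<close>, so
  layer 2 is a single point. Only layer 1 may then have an extra point below the window.\<close>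

lemma no_fork_imp_path_like:
  assumes nofork: "\<And>n. n \<ge> K \<Longrightarrow> \<not> has_fork A n" and K: "K \<ge> 3" and "A \<noteq> {}"
  shows "\<exists>l u a m. set u \<subseteq> {int l..int l + int (K + 3)} \<and> encodes (path_word (int l) (K + 3) u a m) A"
proof (cases "\<exists>i. thick i \<and> i \<ge> K + 3")
  case False
  have "p = top (cell p)" if "p \<in> A" "cell p < 0 \<or> 0 + (K + 3) \<le> cell p" for p
    using False that unfolding thick_def by auto
  moreover have "valid 0" using \<open>A \<noteq> {}\<close> by (auto simp: valid_def)
  ultimately show ?thesis using path_word_encodes[of 0 "K + 3"] by blast
next
  case True
  then obtain i where i: "thick i" "i \<ge> K + 3" by blast
  obtain y where y: "y \<in> A" "cell y = i" "y \<noteq> top i" using i unfolding thick_def by blast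
  note ti = valid_top[OF thick_valid[OF i(1)]]
  have no_left: "\<not> left_fork s" if "s \<le> 2" for s
  proof
    assume "left_fork s"
    then have "has_fork A (i - 1 - s + 1)"
      using y ti i(2) K that by (intro left_fork_imp_has_fork[of s y "top i"]) auto
    moreover have "K \<le> i - 1 - s + 1" using i(2) that by linarith
    ultimately show False using nofork by blast
  qed
  define l where "l = (LEAST j. thick j \<and> j \<ge> 2)"
  have l: "thick l" "l \<ge> 2" "\<And>j. thick j \<Longrightarrow> j \<ge> 2 \<Longrightarrow> l \<le> j"
    using LeastI[of "\<lambda>j. thick j \<and> j \<ge> 2" i] Least_le[of "\<lambda>j. thick j \<and> j \<ge> 2"] i unfolding l_def by auto
  have "l \<ge> 3" using thick_window[OF nofork K l(1,2) i(1)] i(2) by simp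
  have window: "l \<le> j \<and> j \<le> l + K" if "thick j" "j \<ge> 2" for j
    using l(3) thick_window[OF nofork K l(1,2)] that by blast
  have val: "valid l" "valid 2" using thick_valid[OF l(1)] valid_mono[OF _ l(2)] by auto
  have single: "p = top (cell p)" if "p \<in> A" "cell p < l \<or> l + (K + 3) \<le> cell p" "cell p \<noteq> 1" for p
  proof (rule ccontr)
    assume "p \<noteq> top (cell p)"
    then have thick: "thick (cell p)" using that(1) unfolding thick_def by blast
    show False
    proof (cases "cell p = 0")
      case True
      then show False using cell_zero[of p "top 0"] top_in[of p 0] that(1) \<open>p \<noteq> top (cell p)\<close> by simp
    next
      case False
      then show False using window[OF thick] that(2,3) by linarith
    qed
  qed
  show ?thesis
  proof (cases "\<exists>x\<in>A. cell x = 1 \<and> x \<noteq> top 1")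
    case False
    then have "p = top (cell p)" if "p \<in> A" "cell p < l \<or> l + (K + 3) \<le> cell p" for p
      using single[OF that] that(1) by metis
    then show ?thesis using path_word_encodes[of l "K + 3"] val(1) by blast
  next
    case True
    then obtain x where x: "x \<in> A" "cell x = 1" "x \<noteq> top 1" by blast
    \<comment> \<open>An extra point of cell 1 adjacent to \<open>top 2\<close> would give
      \<open>left_fork 2\<close>; two extra points not adjacent to it would give
      \<open>left_fork 0\<close>. Hence at most one remains.\<close>
    have nonadj: "\<not> inversion u (top 2)" if "u \<in> A" "cell u = 1" "u \<noteq> top 1" for u
      using left_fork_after[of u] that val(2) no_left[of 2] by (auto simp: numeral_2_eq_2)
    have "p = top (cell p)" if "p \<in> A" "p \<noteq> x" "cell p < l \<or> l + (K + 3) \<le> cell p" for p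
      using single[OF that(1,3)] left_fork_zero[OF x(1) that(1)] that x nonadj no_left[of 0] by fastforce
    then show ?thesis using path_word_encodes_extra[OF x nonadj[OF x], of l "K + 3"] val(1) \<open>l \<ge> 3\<close> by blast
  qed
qed

end

lemma path_likeI:
  assumes "set u \<subseteq> {int l..int l + int N}" "encodes (path_word (int l) N u a m) S"
  shows "S \<in> path_like N"
proof -
  define j where "j = int l div 2"
  have "path_word (int l) N u a m
      = map (\<lambda>c. c + 2 * j) (path_word (int l mod 2) N (map (\<lambda>c. c - 2 * j) u) a m)"
    by (simp add: path_word_def j_def rev_map comp_def minus_mod_eq_mult_div[symmetric] algebra_simps)
  then have "encodes (path_word (int l mod 2) N (map (\<lambda>c. c - 2 * j) u) a m) S"
    using assms(2) encodes_shift by metis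
  moreover have "int l - 2 * j = int l mod 2" by (simp add: j_def minus_mult_div_eq_mod)
  then have "set (map (\<lambda>c. c - 2 * j) u) \<subseteq> {int l mod 2..int l mod 2 + int N}" using assms(1) by fastforce
  moreover have "int l mod 2 \<in> {0, 1}" by auto
  ultimately show ?thesis
    unfolding path_like_def path_words_def mem_Collect_eq
    by (intro bexI[of _ "path_word (int l mod 2) N (map (\<lambda>c. c - 2 * j) u) a m"] CollectI exI conjI) (rule refl | assumption)+
qed

section \<open>The greedy staircase of a 321-avoiding point set\<close>

definition avoids_321 :: "(nat \<times> nat) set \<Rightarrow> bool" where
  "avoids_321 S \<longleftrightarrow> \<not> (\<exists>p\<in>S. \<exists>q\<in>S. \<exists>r\<in>S. fst p < fst q \<and> fst q < fst r \<and> snd q < snd p \<and> snd r < snd q)"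

text \<open>
  Starting from the leftmost point, \<open>X (i + 1)\<close> is the rightmost abscissa among the points of height
  at most \<open>Y i\<close>, and \<open>Y i\<close> is the greatest height among the points of abscissa at most \<open>X i\<close>. The
  column (row) of a point is the least \<open>i\<close> such that \<open>X i\<close> (\<open>Y i\<close>) bounds it. The points with a
  column form the connected component of the leftmost point, and their cells are the layers of
  breadth-first search in the inversion graph.
\<close>

lemma greedy_staircase:
  assumes gen: "generic S" and av: "avoids_321 S" and "S \<noteq> {}"
  shows "\<exists>A B cell top. S = A \<union> B \<and> A \<noteq> {} \<and> below A B \<and> staircase A cell top"
proof -
  have fin: "finite S" using gen by (simp add: generic_def)
  have fst_eq: "p = q" if "p \<in> S" "q \<in> S" "fst p = fst q" for p q
    using gen that unfolding generic_def inj_on_def by blast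
  have snd_eq: "p = q" if "p \<in> S" "q \<in> S" "snd p = snd q" for p q
    using gen that unfolding generic_def inj_on_def by blast
  have "Min (fst ` S) \<in> fst ` S" using fin \<open>S \<noteq> {}\<close> by (intro Min_in) auto
  then obtain p0 where p0: "p0 \<in> S" "fst p0 = Min (fst ` S)" by auto
  have left: "fst p0 \<le> fst p" if "p \<in> S" for p using p0(2) fin that by simp
  define f where "f y = Max (fst ` {p \<in> S. snd p \<le> y})" for y
  define g where "g x = Max (snd ` {p \<in> S. fst p \<le> x})" for x
  define X where "X i = ((f \<circ> g) ^^ i) (fst p0)" for i
  define Y where "Y i = g (X i)" for i
  have XS: "X (Suc i) = f (Y i)" for i by (simp add: X_def Y_def)
  have X0: "X 0 = fst p0" by (simp add: X_def)
  have f_ge: "fst p \<le> f y" if "p \<in> S" "snd p \<le> y" for p y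
    using that fin by (auto simp: f_def intro!: Max_ge)
  have g_ge: "snd p \<le> g x" if "p \<in> S" "fst p \<le> x" for p x
    using that fin by (auto simp: g_def intro!: Max_ge)
  have f_att: "\<exists>r\<in>S. fst r = f y \<and> snd r \<le> y" if "p \<in> S" "snd p \<le> y" for p y
  proof -
    have "f y \<in> fst ` {p \<in> S. snd p \<le> y}" 
    proof -
      have "fst p \<in> fst ` {p \<in> S. snd p \<le> y}" using that by blast
      then have "fst ` {p \<in> S. snd p \<le> y} \<noteq> {}" by blast
      then show ?thesis unfolding f_def using fin by (intro Max_in) simp_all
    qed
    then show ?thesis by force
  qed
  have g_att: "\<exists>r\<in>S. snd r = g x \<and> fst r \<le> x" if "p \<in> S" "fst p \<le> x" for p x
  proof -
    have "g x \<in> snd ` {p \<in> S. fst p \<le> x}" 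
    proof -
      have "snd p \<in> snd ` {p \<in> S. fst p \<le> x}" using that by blast
      then have "snd ` {p \<in> S. fst p \<le> x} \<noteq> {}" by blast
      then show ?thesis unfolding g_def using fin by (intro Max_in) simp_all
    qed
    then show ?thesis by force
  qed
  have X_Y: "snd p \<le> Y i" if "p \<in> S" "fst p \<le> X i" for p i using g_ge that by (simp add: Y_def)
  have Y_X: "fst p \<le> X (Suc i)" if "p \<in> S" "snd p \<le> Y i" for p i using f_ge that by (simp add: XS)
  have p0X: "fst p0 \<le> X i" for i
  proof (induction i)
    case (Suc i)
    then show ?case using Y_X[OF p0(1) X_Y[OF p0(1) Suc]] by simp
  qed (simp add: X0)
  have "\<exists>r\<in>S. snd r = Y i \<and> fst r \<le> X i" for i using g_att[OF p0(1) p0X] by (simp add: Y_def)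
  then obtain RY where RY: "\<And>i. RY i \<in> S" "\<And>i. snd (RY i) = Y i" "\<And>i. fst (RY i) \<le> X i" by metis
  have "\<exists>r\<in>S. fst r = X (Suc i) \<and> snd r \<le> Y i" for i
    using f_att[OF p0(1) X_Y[OF p0(1) p0X]] by (simp add: XS)
  then obtain RX where RX: "\<And>i. RX i \<in> S" "\<And>i. fst (RX i) = X (Suc i)" "\<And>i. snd (RX i) \<le> Y i" by metis
  have X_mono: "X i \<le> X j" if "i \<le> j" for i j
  proof (rule lift_Suc_mono_le[of X, OF _ that])
    fix i
    show "X i \<le> X (Suc i)"
    proof (cases i)
      case 0
      then show ?thesis using p0X[of 1] X0 by simp
    next
      case (Suc k)
      have "fst (RX k) \<le> X (Suc k)" by (simp add: RX(2))
      then show ?thesis using Y_X[OF RX(1) X_Y[OF RX(1)]] Suc RX(2) by metis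
    qed
  qed
  have Y_mono: "Y i \<le> Y j" if "i \<le> j" for i j
    using X_Y[OF RY(1), of i j] RY(2,3)[of i] X_mono[OF that] by simp
  \<comment> \<open>Each bound is a function of the preceding one, so the first repetition freezes
    the sequence.\<close>
  have X_stable: "X j \<le> X i" if "X (Suc i) = X i" for i j
  proof (cases "j \<le> i")
    case False
    have "X (i + k) = X i" for k
    proof (induction k)
      case (Suc k)
      have "X (i + Suc k) = f (g (X (i + k)))" using XS[of "i + k"] by (simp add: Y_def)
      also have "\<dots> = X (Suc i)" using Suc XS[of i] by (simp add: Y_def)
      finally show ?case using that by simp
    qed simp
    from this[of "j - i"] show ?thesis using False by simp
  qed (simp add: X_mono)
  have Y_stable: "Y j \<le> Y i" if "Y (Suc i) = Y i" for i j
  proof -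
    have "X (Suc (Suc i)) = X (Suc i)" using that XS by simp
    then have "X j \<le> X (Suc i)" by (rule X_stable)
    then have "Y j \<le> Y (Suc i)" using X_Y[OF RY(1), of j "Suc i"] RY(2,3)[of j] by simp
    then show ?thesis using that by simp
  qed
  define A where "A = {p \<in> S. \<exists>i. fst p \<le> X i}"
  define B where "B = S - A"
  have AS: "p \<in> S" if "p \<in> A" for p using that by (simp add: A_def)
  have "below A B"
    unfolding below_def
  proof (intro ballI)
    fix a b assume a: "a \<in> A" and b: "b \<in> B"
    then obtain i where i: "a \<in> S" "fst a \<le> X i" by (auto simp: A_def)
    have bX: "b \<in> S" "X j < fst b" for j using b by (auto simp: A_def B_def not_le)
    then have "Y j < snd b" for j using Y_X[of b j] by (metis not_le)
    then show "fst a < fst b \<and> snd a < snd b" using bX(2)[of i] i X_Y[OF i] by (metis le_less_trans)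
  qed
  define col where "col p = (LEAST i. fst p \<le> X i)" for p :: "nat \<times> nat"
  define row where "row p = (LEAST i. snd p \<le> Y i)" for p :: "nat \<times> nat"
  have colX: "fst p \<le> X (col p)" if "p \<in> A" for p
    using that unfolding A_def col_def by (auto intro: LeastI)
  have rowY: "snd p \<le> Y (row p)" if "p \<in> A" for p
    using X_Y[OF AS[OF that] colX[OF that]] unfolding row_def by (rule LeastI)
  have col_le: "col p \<le> i" if "fst p \<le> X i" for p i using that unfolding col_def by (rule Least_le)
  have row_le: "row p \<le> i" if "snd p \<le> Y i" for p i using that unfolding row_def by (rule Least_le)
  have col_gt: "X i < fst p" if "i < col p" for p i using col_le[of p i] that by linarith
  have row_gt: "Y i < snd p" if "i < row p" for p i using row_le[of p i] that by linarith
  have row_col: "row p \<le> col p" "col p \<le> Suc (row p)" if "p \<in> A" for p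
    using row_le[OF X_Y[OF AS[OF that] colX[OF that]]] col_le[OF Y_X[OF AS[OF that] rowY[OF that]]] by auto
  \<comment> \<open>Since the column exceeds the row by 0 or 1, the sum determines both.\<close>
  define cell where "cell p = col p + row p" for p
  have cell_div: "(cell p + 1) div 2 = col p" "cell p div 2 = row p" if "p \<in> A" for p
    using row_col[OF that] by (auto simp: cell_def)
  \<comment> \<open>Cell \<open>2 * i\<close> has column and row \<open>i\<close>, and
    \<open>RY i\<close> attains its height bound; cell \<open>2 * i + 1\<close> has column
    \<open>i + 1\<close>, and \<open>RX i\<close> attains its abscissa bound.\<close>
  define top where "top c = (if even c then RY (c div 2) else RX (c div 2))" for c :: nat
  have topA: "top c \<in> A" for c
    using RX[of "c div 2"] RY[of "c div 2"] unfolding A_def top_def by (auto intro: eq_refl)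
  have top_even: "top (2 * i) = RY i" and top_odd: "top (Suc (2 * i)) = RX i" for i by (simp_all add: top_def)
  have top_cell: "cell (top c) = c" if p: "p \<in> A" "c \<le> cell p" for p c
  proof (cases "even c")
    case True
    then obtain i where i: "c = 2 * i" by (elim evenE)
    have "col (RY i) \<le> i" using RY(3) by (rule col_le)
    \<comment> \<open>An earlier row would mean that \<open>Y\<close> repeats a value before
      \<open>i\<close> and stays constant, leaving no room for \<open>p\<close> in cell
      \<open>c\<close> or beyond. The odd case is the same with \<open>X\<close>.\<close>
    moreover have "i \<le> row (RY i)"
    proof (rule ccontr)
      assume "\<not> i \<le> row (RY i)"
      then obtain k where k: "i = Suc k" "row (RY i) \<le> k" by (cases i) auto
      have "Y i \<le> Y k"
        using rowY[OF topA[of c, unfolded i top_even]] Y_mono[OF k(2)] RY(2)[of i] by simp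
      then have "Y (Suc k) = Y k" using Y_mono[of k i] k(1) by simp
      then have "snd p \<le> Y k" using rowY[OF p(1)] Y_stable[of k "row p"] by simp
      then have "row p \<le> k" by (rule row_le)
      then show False using row_col[OF p(1)] p(2) i k(1) by (simp add: cell_def)
    qed
    ultimately show ?thesis
      using row_col[OF topA[of c, unfolded i top_even]] by (simp add: i top_even cell_def)
  next
    case False
    then obtain i where i: "c = Suc (2 * i)" by (auto elim: oddE)
    have "row (RX i) \<le> i" using RX(3) by (rule row_le)
    moreover have "Suc i \<le> col (RX i)"
    proof (rule ccontr)
      assume "\<not> Suc i \<le> col (RX i)"
      then have k: "col (RX i) \<le> i" by simp
      have "X (Suc i) \<le> X i"
        using colX[OF topA[of c, unfolded i top_odd]] X_mono[OF k] RX(2)[of i] by simp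
      then have "X (Suc i) = X i" using X_mono[of i "Suc i"] by simp
      then have "fst p \<le> X i" using colX[OF p(1)] X_stable[of i "col p"] by simp
      then have "col p \<le> i" by (rule col_le)
      then show False using row_col[OF p(1)] p(2) i by (simp add: cell_def)
    qed
    ultimately show ?thesis
      using row_col[OF topA[of c, unfolded i top_odd]] by (simp add: i top_odd cell_def)
  qed
  have zero: "p = p0" if "p \<in> A" "cell p = 0" for p
  proof -
    have "fst p \<le> fst p0" using colX[OF that(1)] that(2) X0 by (simp add: cell_def)
    then show ?thesis using left[OF AS[OF that(1)]] fst_eq[OF AS[OF that(1)] p0(1)] by simp
  qed
  have incr: "snd p < snd q" if p: "p \<in> A" and q: "q \<in> A" and pq: "cell p = cell q" "fst p < fst q" for p q
  proof (rule ccontr)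
    assume "\<not> snd p < snd q"
    then have inv: "snd q < snd p" using snd_eq[OF AS[OF p] AS[OF q]] pq(2) by (metis less_irrefl linorder_neqE_nat)
    have same: "col p = col q" "row p = row q" using cell_div[OF p] cell_div[OF q] pq(1) by auto
    \<comment> \<open>A descent inside a cell extends to a 321: in an even cell by a point
      \<open>RX k\<close> to the lower right, in an odd cell by a point \<open>RY k\<close> to the
      upper left. Cell 0 has only one point.\<close>
    show False
    proof (cases "col q = row q")
      case True
      show False
      proof (cases "col q")
        case 0
        then have "cell p = 0" "cell q = 0" using True same by (simp_all add: cell_def)
        then show False using zero p q pq(2) by (metis less_irrefl)
      next
        case (Suc k)
        have "snd (RX k) < snd q" using RX(3)[of k] row_gt[of k q] True Suc by simp
        moreover have "fst q < fst (RX k)"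
        proof -
          have "fst q \<le> fst (RX k)" using colX[OF q] Suc RX(2)[of k] by simp
          moreover have "fst q \<noteq> fst (RX k)" using fst_eq[OF AS[OF q] RX(1)] \<open>snd (RX k) < snd q\<close> by fastforce
          ultimately show ?thesis by simp
        qed
        ultimately show False using av pq(2) inv AS[OF p] AS[OF q] RX(1)[of k] unfolding avoids_321_def by blast
      qed
    next
      case False
      then have cq: "col q = Suc (row q)" using row_col[OF q] by simp
      define k where "k = row q"
      have "fst (RY k) < fst p" using RY(3)[of k] col_gt[of k p] cq same by (simp add: k_def)
      moreover have "snd p < snd (RY k)"
      proof -
        have "snd p \<le> snd (RY k)" using rowY[OF p] same RY(2)[of k] by (simp add: k_def)
        moreover have "snd p \<noteq> snd (RY k)" using snd_eq[OF AS[OF p] RY(1)] \<open>fst (RY k) < fst p\<close> by fastforce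
        ultimately show ?thesis by simp
      qed
      ultimately show False using av pq(2) inv AS[OF p] AS[OF q] RY(1)[of k] unfolding avoids_321_def by blast
    qed
  qed
  have "staircase A cell top"
  proof
    show "generic A" using generic_subset[OF gen] by (auto simp: A_def)
    fix p q c
    show "fst p < fst q" if "p \<in> A" "q \<in> A" "(cell p + 1) div 2 < (cell q + 1) div 2"
      using colX[OF that(1)] col_gt[of "col p" q] that(3) cell_div[OF that(1)] cell_div[OF that(2)] by simp
    show "snd p < snd q" if "p \<in> A" "q \<in> A" "cell p div 2 < cell q div 2"
      using rowY[OF that(1)] row_gt[of "row p" q] that(3) cell_div[OF that(1)] cell_div[OF that(2)] by simp
    show "p \<in> A \<Longrightarrow> q \<in> A \<Longrightarrow> cell p = cell q \<Longrightarrow> fst p < fst q \<Longrightarrow> snd p < snd q" by (rule incr)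
    show "p \<in> A \<Longrightarrow> q \<in> A \<Longrightarrow> cell p = 0 \<Longrightarrow> cell q = 0 \<Longrightarrow> p = q" using zero by metis
    show "p \<in> A \<Longrightarrow> c \<le> cell p \<Longrightarrow> top c \<in> A \<and> cell (top c) = c" using topA top_cell by blast
    show "key c p < key c (top c)" if p: "p \<in> A" "cell p = Suc c" for c
    proof -
      have ne: "p \<noteq> top c" using top_cell[OF p(1), of c] p(2) by auto
      show ?thesis
      proof (cases "even c")
        case True
        then obtain i where i: "c = 2 * i" by (elim evenE)
        have "row p = i" using cell_div(2)[OF p(1)] p(2) i by simp
        then have "snd p \<le> snd (top c)" using rowY[OF p(1)] RY(2)[of i] by (simp add: i top_even)
        moreover have "snd p \<noteq> snd (top c)" using snd_eq[OF AS[OF p(1)] AS[OF topA]] ne by blast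
        ultimately show ?thesis using True by (simp add: key_def)
      next
        case False
        then obtain i where i: "c = Suc (2 * i)" by (auto elim: oddE)
        have "col p = Suc i" using cell_div(1)[OF p(1)] p(2) i by simp
        then have "fst p \<le> fst (top c)" using colX[OF p(1)] RX(2)[of i] by (simp add: i top_odd)
        moreover have "fst p \<noteq> fst (top c)" using fst_eq[OF AS[OF p(1)] AS[OF topA]] ne by blast
        ultimately show ?thesis using False by (simp add: key_def)
      qed
    qed
    show "fst p \<le> fst (top (cell p))" if p: "p \<in> A"
    proof (cases "even (cell p)")
      case True
      then obtain i where i: "cell p = 2 * i" by (elim evenE)
      have "row p = i" using cell_div(2)[OF p] i by simp
      then have "\<not> snd (top (cell p)) < snd p" using rowY[OF p] RY(2)[of i] by (simp add: i top_even)
      then show ?thesis using incr[OF topA p, of "cell p"] top_cell[OF p, of "cell p"] by fastforce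
    next
      case False
      then obtain i where i: "cell p = Suc (2 * i)" by (auto elim: oddE)
      have "col p = Suc i" using cell_div(1)[OF p] i by simp
      then show ?thesis using colX[OF p] RX(2)[of i] by (simp add: i top_odd)
    qed
  qed
  moreover have "S = A \<union> B" by (auto simp: A_def B_def)
  moreover have "p0 \<in> A" using p0(1) X0 by (auto simp: A_def intro: exI[of _ 0])
  then have "A \<noteq> {}" by blast
  ultimately show ?thesis using \<open>below A B\<close> by blast
qed

lemma sum_of_path_like:
  assumes "generic S" "avoids_321 S" "\<And>n. n \<ge> K \<Longrightarrow> \<not> has_fork S n" "K \<ge> 3"
  shows "\<exists>As. set As \<subseteq> path_like (K + 3) \<and> sum_of As S"
  using assms(1-3)
proof (induction "card S" arbitrary: S rule: less_induct)
  case less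
  show ?case
  proof (cases "S = {}")
    case True
    then show ?thesis by (intro exI[of _ "[]"]) simp
  next
    case False
    obtain A B cell top where AB: "S = A \<union> B" "A \<noteq> {}" "below A B" and stair: "staircase A cell top"
      using greedy_staircase[OF less.prems(1,2) False] by blast
    have sub: "has_fork S n" if "has_fork T n" "T \<subseteq> S" for T n
      using that unfolding has_fork_def by (meson subset_trans)
    have "A \<in> path_like (K + 3)"
    proof -
      have "\<exists>l u a m. set u \<subseteq> {int l..int l + int (K + 3)} \<and> encodes (path_word (int l) (K + 3) u a m) A"
        using staircase.no_fork_imp_path_like[OF stair _ assms(4) AB(2)] less.prems(3) sub AB(1) by blast
      then show ?thesis using path_likeI by blast
    qed
    moreover have "\<exists>As. set As \<subseteq> path_like (K + 3) \<and> sum_of As B"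
    proof (rule less.hyps)
      have "A \<inter> B = {}" using AB(3) unfolding below_def by blast
      then have "B \<subset> S" using AB(1,2) by blast
      then show "card B < card S" using less.prems(1) by (intro psubset_card_mono) (auto simp: generic_def)
      show "generic B" using generic_subset less.prems(1) AB(1) by blast
      show "avoids_321 B" using less.prems(2) AB(1) unfolding avoids_321_def by blast
      show "\<not> has_fork B n" if "n \<ge> K" for n using less.prems(3)[OF that] sub[of B n] AB(1) by blast
    qed
    ultimately show ?thesis using AB by (metis insert_subset list.simps(15) sum_of.simps(2))
  qed
qed

section \<open>From point sets back to permutation classes\<close>

lemma Av_321_points:
  assumes "\<pi> \<in> Av [3, 2, 1]"
  shows "avoids_321 (points \<pi>)"
  unfolding avoids_321_def
proof
  assume "\<exists>p\<in>points \<pi>. \<exists>q\<in>points \<pi>. \<exists>r\<in>points \<pi>. fst p < fst q \<and> fst q < fst r \<and> snd q < snd p \<and> snd r < snd q"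
  then obtain p q r where pqr: "p \<in> points \<pi>" "q \<in> points \<pi>" "r \<in> points \<pi>"
    "fst p < fst q" "fst q < fst r" "snd q < snd p" "snd r < snd q" by blast
  have pts: "points [3, 2, 1] = {(1, 3), (2, 2), (3, 1)}"
    by (auto simp: points_image lessThan_Suc numeral_3_eq_3)
  have "order_emb (\<lambda>x. if fst x = 1 then p else if fst x = 2 then q else r) (points [3, 2, 1]) (points \<pi>)"
    unfolding order_emb_def pts using pqr by auto
  then have "[3, 2, 1] \<preceq> \<pi>" by (rule order_emb_points_imp_contained)
  then show False using assms by (simp add: Av_def)
qed

theorem theorem9p3:
  fixes C :: "nat list set"
  assumes "perm_class C"
    and "C \<subseteq> Av [3, 2, 1]"
  shows "well_quasi_ordered C \<longleftrightarrow> finite (C \<inter> fork_perms)"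
proof
  assume "well_quasi_ordered C"
  moreover have "antichain (C \<inter> fork_perms)"
    using fork_perms_antichain unfolding antichain_def by blast
  ultimately show "finite (C \<inter> fork_perms)" unfolding well_quasi_ordered_def by blast
next
  assume fin: "finite (C \<inter> fork_perms)"
  \<comment> \<open>A fork with \<open>n \<ge> K\<close> path vertices has \<open>n + 4\<close>
    points, more than any fork in the class. Inserting 3 makes \<open>Max\<close> meaningful when
    there are none and supplies the lower bound for the window argument.\<close>
  define K where "K = Max (insert 3 (length ` (C \<inter> fork_perms)))"
  have K: "K \<ge> 3" "\<And>\<sigma>. \<sigma> \<in> C \<Longrightarrow> \<sigma> \<in> fork_perms \<Longrightarrow> length \<sigma> \<le> K"
    unfolding K_def using fin by (auto intro: Max_ge)
  have "\<exists>As. set As \<subseteq> path_like (K + 3) \<and> sum_of As (points \<pi>)" if "\<pi> \<in> C" for \<pi>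
  proof (rule sum_of_path_like[OF _ _ _ K(1)])
    have "\<pi> \<in> perms" using assms(1) that by (auto simp: perm_class_def)
    then show gen: "generic (points \<pi>)" by (simp add: generic_points mem_perms_iff)
    show "avoids_321 (points \<pi>)" using Av_321_points assms(2) that by blast
    show "\<not> has_fork (points \<pi>) n" if n: "n \<ge> K" for n
    proof
      assume "has_fork (points \<pi>) n"
      then obtain \<sigma> where \<sigma>: "\<sigma> \<in> fork_perms" "\<sigma> \<preceq> \<pi>" "length \<sigma> = n + 4"
        using has_fork_imp_fork_perm[OF gen] n K(1) by fastforce
      then have "\<sigma> \<in> C" using assms(1) \<open>\<pi> \<in> C\<close> unfolding perm_class_def fork_perms_def by blast
      then show False using K(2)[OF _ \<sigma>(1)] \<sigma>(3) n by simp
    qed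
  qed
  then have "wqo_set (\<preceq>) C" by (rule path_like_sums_wqo)
  then show "well_quasi_ordered C" by (rule wqo_set_imp_well_quasi_ordered)
qed

end
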